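(* Let $G$ be a locally compact, second countable, Hausdorff topological group which is the union of an ascending sequence $G_1\subset G_2\subset G_3\subset\cdots$ of open subgroups. Let $\underline{\mathrm{M}}G$ denote the space of compactly supported positive measures on $G$ with total measure in $(1/2,1]$, with the weak* topology, and let $(\underline{\mathrm{M}}G)_{\mathrm{lim}}$ denote the same set $\underline{\mathrm{M}}G=\bigcup_n\underline{\mathrm{M}}G_n$ furnished with the direct limit topology with respect to the ascending sequence of subspaces $\underline{\mathrm{M}}G_1\subset\underline{\mathrm{M}}G_2\subset\cdots$. Then $(\underline{\mathrm{M}}G)_{\mathrm{lim}}$ is $G$-homotopy equivalent to $\underline{\mathrm{M}}G$.
   Context: For a locally compact, second countable, Hausdorff group $H$, $\underline{\mathrm{M}}H$ is the set of all compactly supported positive measures on $H$ with total measure in the interval $(1/2,1]$, topologized with the weak* topology: a basis is given by the sets $\{\lambda\in\underline{\mathrm{M}}H: |\int f_k\,d\mu-\int f_k\,d\lambda|<\varepsilon,\ k=1,\dots,n\}$ with $\mu\in\underline{\mathrm{M}}H$, $f_1,\dots,f_n\in C_c(H)$, $\varepsilon>0$. For an open subgroup $G_n\subset G$, $\underline{\mathrm{M}}G_n$ is regarded as a subset of $\underline{\mathrm{M}}G$ by extending measures by zero outside $G_n$. The direct limit topology on a union $X=\bigcup_n X_n$ of an ascending sequence of topological spaces is the one in which a set is open if and only if its intersection with each $X_n$ is open in $X_n$. $G$ acts on $\underline{\mathrm{M}}G$ (in either topology) by left translation of measures. Two $G$-spaces are $G$-homotopy equivalent if there are continuous $G$-equivariant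 maps in both directions whose two composites are homotopic to the identity maps through continuous $G$-equivariant maps. *)

theory Defs
  imports "HOL-Analysis.Analysis"
begin

text \<open>
  The library class \<^class>\<open>topological_group_add\<close> does not assume commutativity; arbitrary
  topological groups are therefore written additively: \<open>g + h\<close> is the product,
  \<open>- g\<close> the inverse, \<open>0\<close> the identity.
\<close>

definition subgroup_add :: "'a::group_add set \<Rightarrow> bool" where
  "subgroup_add H \<longleftrightarrow> 0 \<in> H \<and> (\<forall>x\<in>H. \<forall>y\<in>H. x + y \<in> H) \<and> (\<forall>x\<in>H. - x \<in> H)"

text \<open>
  Borel measures on a subset \<open>H\<close> are measures on \<open>restrict_space borel H\<close>. On a locally compact,
  second countable Hausdorff space every finite Borel measure is Radon, so no regularity
  condition is needed. The whole group is the case \<open>H = UNIV\<close>.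
\<close>

definition cpt_measures :: "'a::topological_space set \<Rightarrow> 'a measure set" where
  "cpt_measures H =
     {\<mu>. sets \<mu> = sets (restrict_space borel H) \<and>
         (\<exists>K. compact K \<and> K \<subseteq> H \<and> emeasure \<mu> (H - K) = 0) \<and>
         emeasure \<mu> (space \<mu>) \<in> {1/2 <.. 1}}"

definition cpt_supp_functions :: "'a::topological_space set \<Rightarrow> ('a \<Rightarrow> real) set" where
  "cpt_supp_functions H =
     {f. continuous_on H f \<and> (\<exists>K. compact K \<and> K \<subseteq> H \<and> (\<forall>x\<in>H - K. f x = 0))}"

definition weak_star_topology :: "'a::topological_space set \<Rightarrow> 'a measure topology" where
  "weak_star_topology H =
     topology_generated_by
       {{\<nu> \<in> cpt_measures H. \<forall>f\<in>F. \<bar>(\<integral>x. f x \<partial>\<mu>) - (\<integral>x. f x \<partial>\<nu>)\<bar> < \<epsilon>} | \<mu> F \<epsilon>.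
          \<mu> \<in> cpt_measures H \<and> finite F \<and> F \<subseteq> cpt_supp_functions H \<and> 0 < \<epsilon>}"

text \<open>The push-forward along the inclusion sends \<open>A\<close> to \<open>\<mu> (A \<inter> H)\<close>.\<close>

definition extend_by_zero :: "'a::topological_space measure \<Rightarrow> 'a measure" where
  "extend_by_zero \<mu> = distr \<mu> borel (\<lambda>x. x)"

definition left_translate :: "'a::{topological_space, plus} \<Rightarrow> 'a measure \<Rightarrow> 'a measure" where
  "left_translate g \<mu> = distr \<mu> borel (\<lambda>x. g + x)"

definition direct_limit_topology :: "(nat \<Rightarrow> 'b topology) \<Rightarrow> 'b topology" where
  "direct_limit_topology X =
     topology (\<lambda>U. U \<subseteq> (\<Union>n. topspace (X n)) \<and> (\<forall>n. openin (X n) (U \<inter> topspace (X n))))"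

lemma openin_direct_limit_topology:
  "openin (direct_limit_topology X) U \<longleftrightarrow>
     U \<subseteq> (\<Union>n. topspace (X n)) \<and> (\<forall>n. openin (X n) (U \<inter> topspace (X n)))"
proof -
  have "istopology (\<lambda>U. U \<subseteq> (\<Union>n. topspace (X n)) \<and> (\<forall>n. openin (X n) (U \<inter> topspace (X n))))"
    unfolding istopology_def
  proof (intro conjI allI impI)
    fix S T n
    assume "S \<subseteq> (\<Union>n. topspace (X n)) \<and> (\<forall>n. openin (X n) (S \<inter> topspace (X n)))"
      and "T \<subseteq> (\<Union>n. topspace (X n)) \<and> (\<forall>n. openin (X n) (T \<inter> topspace (X n)))"
    then have "openin (X n) ((S \<inter> topspace (X n)) \<inter> (T \<inter> topspace (X n)))"
      by blast
    then show "openin (X n) (S \<inter> T \<inter> topspace (X n))"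
      by (simp add: Int_ac)
  next
    fix \<K> n
    assume "\<forall>K\<in>\<K>. K \<subseteq> (\<Union>n. topspace (X n)) \<and> (\<forall>n. openin (X n) (K \<inter> topspace (X n)))"
    then have "openin (X n) (\<Union>K\<in>\<K>. K \<inter> topspace (X n))"
      by blast
    then show "openin (X n) (\<Union>\<K> \<inter> topspace (X n))"
      by (simp add: Int_commute Int_Union)
  qed blast+
  then show ?thesis
    by (simp add: direct_limit_topology_def)
qed

lemma topspace_direct_limit_topology:
  "topspace (direct_limit_topology X) = (\<Union>n. topspace (X n))"
proof
  show "topspace (direct_limit_topology X) \<subseteq> (\<Union>n. topspace (X n))"
    using openin_topspace[of "direct_limit_topology X"]
    unfolding openin_direct_limit_topology by blast
  have "(\<Union>m. topspace (X m)) \<inter> topspace (X n) = topspace (X n)" for n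
    by blast
  then have "openin (direct_limit_topology X) (\<Union>n. topspace (X n))"
    by (simp add: openin_direct_limit_topology)
  then show "(\<Union>n. topspace (X n)) \<subseteq> topspace (direct_limit_topology X)"
    by (rule openin_subset)
qed

definition measures_lim_topology ::
    "(nat \<Rightarrow> 'a::topological_space set) \<Rightarrow> 'a measure topology" where
  "measures_lim_topology G =
     direct_limit_topology
       (\<lambda>n. subtopology (weak_star_topology UNIV) (extend_by_zero ` cpt_measures (G n)))"

definition G_space ::
    "'b topology \<Rightarrow> ('a::{topological_space, group_add} \<Rightarrow> 'b \<Rightarrow> 'b) \<Rightarrow> bool" where
  "G_space X act \<longleftrightarrow>
     (\<forall>x\<in>topspace X. act 0 x = x) \<and>
     (\<forall>g h. \<forall>x\<in>topspace X. act (g + h) x = act g (act h x)) \<and>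
     continuous_map (prod_topology euclidean X) X (\<lambda>(g, x). act g x)"

definition equivariant ::
    "'b topology \<Rightarrow> ('a \<Rightarrow> 'b \<Rightarrow> 'b) \<Rightarrow> ('a \<Rightarrow> 'c \<Rightarrow> 'c) \<Rightarrow> ('b \<Rightarrow> 'c) \<Rightarrow> bool" where
  "equivariant X actX actY f \<longleftrightarrow> (\<forall>g. \<forall>x\<in>topspace X. f (actX g x) = actY g (f x))"

definition G_homotopy_equivalent ::
    "'b topology \<Rightarrow> ('a::{topological_space, group_add} \<Rightarrow> 'b \<Rightarrow> 'b) \<Rightarrow>
     'c topology \<Rightarrow> ('a \<Rightarrow> 'c \<Rightarrow> 'c) \<Rightarrow> bool" where
  "G_homotopy_equivalent X actX Y actY \<longleftrightarrow>
     G_space X actX \<and> G_space Y actY \<and>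
     (\<exists>f h. continuous_map X Y f \<and> equivariant X actX actY f \<and>
            continuous_map Y X h \<and> equivariant Y actY actX h \<and>
            homotopic_with (equivariant X actX actX) X X (h \<circ> f) id \<and>
            homotopic_with (equivariant Y actY actY) Y Y (f \<circ> h) id)"

end

theory Submission
  imports Defs
begin

text \<open>
  The identity map is continuous from the limit topology to the weak* topology, and it is
  equivariant. The point is to find a homotopy inverse: an equivariant map that sends a measure
  \<open>\<mu>\<close> to one whose support lies, locally uniformly in \<open>\<mu>\<close>, in a single subgroup \<open>G n\<close>. A weak*
  neighbourhood of \<open>\<mu>\<close> contains measures that have a little mass arbitrarily far out, and this mass
  has to be cut away continuously and equivariantly, while keeping the total mass above one half.

  Total masses lie in \<open>(1/2, 1]\<close>, so at most one left coset of \<open>G n\<close> has mass above \<open>1/2\<close>; this is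
  what \<^emph>\<open>more than half\<close> means throughout. This dominant coset exists for all large \<open>n\<close>, since \<open>\<mu>\<close> has compact support, it grows with
  \<open>n\<close>, and translating \<open>\<mu>\<close> translates it. The mass of a coset is only a semicontinuous function of
  \<open>\<mu>\<close>, because mass can escape to infinity. Therefore it is measured by compactly supported cutoffs
  \<open>\<phi> n\<close> on \<open>G n\<close>: for a point \<open>x\<close>, \<open>rival n x \<mu>\<close> is the supremum of \<open>0\<close> and the excesses over one
  half of the masses seen by the translates of \<open>\<phi> n\<close> centred outside \<open>x + G n\<close>. These translates form
  a noncompact family in general. Nevertheless the supremum is continuous in \<open>\<mu>\<close>
  (\<open>continuous_map_rival\<close>), because a translate that sees more than half of \<open>\<mu>\<close> must overlap any
  other one that does; this leaves a compact set of them.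

  The map \<open>damp 0\<close> multiplies \<open>\<mu>\<close> by the density \<open>max 0 (1 - (\<Sum>n. (n + 1) * rival n x \<mu>))\<close>.
  \<^item> The sum is locally finite in \<open>\<mu>\<close>, since \<open>x\<close> eventually lies in the dominant coset
    (\<open>penalty_eq_sum\<close>); so the density at \<open>x\<close> depends continuously on \<open>\<mu>\<close>.
  \<^item> The density is constant on cosets of the open subgroup \<open>G 0\<close>, and a test function sees only
    finitely many of these; so \<open>damp 0\<close> is weak* continuous (\<open>continuous_map_coset_weighted_integral\<close>).
  \<^item> At the first stage where some cutoff translate sees more than half of \<open>\<mu>\<close>, the density is \<open>1\<close>
    wherever that translate is nonzero; so more than half remains (\<open>cutoff_le_weight\<close>).
  \<^item> If \<open>\<phi> m\<close> sees more than \<open>1/2 + 1/(m + 1)\<close>, an open condition that some \<open>m\<close> satisfies, the density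
    vanishes outside \<open>G m\<close>; so \<open>damp 0\<close> is continuous into the limit (\<open>damp_0_in_stage\<close>).

  The straight line homotopy \<open>damp t\<close> from \<open>damp 0\<close> to the identity never enlarges supports. It is
  therefore a homotopy for either topology: on the limit it is continuous on each stage, and
  products with locally compact spaces such as \<open>[0, 1]\<close> or \<open>G\<close> commute with the direct limit
  (\<open>continuous_map_prod_direct_limit_from\<close>).
\<close>

section \<open>Continuity of maps between abstract topologies\<close>

lemma continuous_map_locally:
  assumes "\<And>x. x \<in> topspace X \<Longrightarrow> \<exists>U. openin X U \<and> x \<in> U \<and> continuous_map (subtopology X U) Y f"
  shows "continuous_map X Y f"
  unfolding continuous_map_def
proof (intro conjI allI impI)
  show "f \<in> topspace X \<rightarrow> topspace Y"
  proof
    fix x assume x: "x \<in> topspace X"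
    with assms obtain U where "x \<in> U" "continuous_map (subtopology X U) Y f" by blast
    with x show "f x \<in> topspace Y" by (auto dest!: continuous_map_funspace)
  qed
  fix V assume V: "openin Y V"
  show "openin X {x \<in> topspace X. f x \<in> V}"
  proof (subst openin_subopen, intro ballI)
    fix x assume "x \<in> {x \<in> topspace X. f x \<in> V}"
    then have x: "x \<in> topspace X" "f x \<in> V" by auto
    with assms obtain U where U: "openin X U" "x \<in> U" "continuous_map (subtopology X U) Y f"
      by blast
    have "openin (subtopology X U) {x \<in> topspace (subtopology X U). f x \<in> V}"
      using U(3) V by (rule openin_continuous_map_preimage)
    then have "openin X {x \<in> topspace (subtopology X U). f x \<in> V}"
      using U(1) by (rule openin_trans_full)
    then show "\<exists>T. openin X T \<and> x \<in> T \<and> T \<subseteq> {x \<in> topspace X. f x \<in> V}"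
      using x U(2) by (intro exI[of _ "{x \<in> topspace (subtopology X U). f x \<in> V}"]) auto
  qed
qed

lemma continuous_map_realI:
  fixes f :: "'b \<Rightarrow> real"
  assumes "\<And>x e. x \<in> topspace X \<Longrightarrow> 0 < e \<Longrightarrow> \<exists>U. openin X U \<and> x \<in> U \<and> (\<forall>y\<in>U. \<bar>f y - f x\<bar> < e)"
  shows "continuous_map X euclideanreal f"
  unfolding continuous_map_def
proof (intro conjI allI impI)
  fix V :: "real set" assume "openin euclideanreal V"
  then have V: "open V" by simp
  show "openin X {x \<in> topspace X. f x \<in> V}"
  proof (subst openin_subopen, intro ballI)
    fix x assume "x \<in> {x \<in> topspace X. f x \<in> V}"
    then have x: "x \<in> topspace X" "f x \<in> V" by auto
    with V obtain e where e: "e > 0" "\<And>y. \<bar>y - f x\<bar> < e \<Longrightarrow> y \<in> V"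
      by (metis open_real)
    obtain U where "openin X U" "x \<in> U" "\<forall>y\<in>U. \<bar>f y - f x\<bar> < e"
      using assms[OF x(1) e(1)] by blast
    then show "\<exists>T. openin X T \<and> x \<in> T \<and> T \<subseteq> {x \<in> topspace X. f x \<in> V}"
      using e(2) openin_subset by (intro exI[of _ U]) fastforce
  qed
qed auto

lemma continuous_map_direct_limit_into:
  assumes "continuous_map Z (X n) f"
  shows "continuous_map Z (direct_limit_topology X) f"
  unfolding continuous_map_def
proof (intro conjI allI impI)
  have f: "f \<in> topspace Z \<rightarrow> topspace (X n)"
    using assms by (rule continuous_map_funspace)
  then show "f \<in> topspace Z \<rightarrow> topspace (direct_limit_topology X)"
    by (auto simp: topspace_direct_limit_topology)
  fix U assume "openin (direct_limit_topology X) U"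
  then have "openin (X n) (U \<inter> topspace (X n))"
    by (simp add: openin_direct_limit_topology)
  then have "openin Z {x \<in> topspace Z. f x \<in> U \<inter> topspace (X n)}"
    using assms by (rule openin_continuous_map_preimage[rotated])
  moreover have "{x \<in> topspace Z. f x \<in> U \<inter> topspace (X n)} = {x \<in> topspace Z. f x \<in> U}"
    using f by auto
  ultimately show "openin Z {x \<in> topspace Z. f x \<in> U}" by simp
qed

lemma continuous_map_direct_limit_from:
  assumes "\<And>n. continuous_map (X n) Y f"
  shows "continuous_map (direct_limit_topology X) Y f"
  unfolding continuous_map_def
proof (intro conjI allI impI)
  show "f \<in> topspace (direct_limit_topology X) \<rightarrow> topspace Y"
    using continuous_map_funspace[OF assms] by (fastforce simp: topspace_direct_limit_topology)
  fix U assume U: "openin Y U"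
  have "openin (X n) ({x \<in> topspace (direct_limit_topology X). f x \<in> U} \<inter> topspace (X n))" for n
  proof -
    have "{x \<in> topspace (direct_limit_topology X). f x \<in> U} \<inter> topspace (X n)
        = {x \<in> topspace (X n). f x \<in> U}"
      by (auto simp: topspace_direct_limit_topology)
    then show ?thesis using openin_continuous_map_preimage[OF assms U] by simp
  qed
  then show "openin (direct_limit_topology X) {x \<in> topspace (direct_limit_topology X). f x \<in> U}"
    unfolding openin_direct_limit_topology by (auto simp: topspace_direct_limit_topology)
qed

text \<open>
  Forming the product with a locally compact Hausdorff space commutes with direct limits.
  Given an open preimage \<open>P\<close> containing \<open>(z, x)\<close>, one shrinks to a compact neighbourhood \<open>J\<close> of
  \<open>z\<close> with \<open>J \<times> {x} \<subseteq> P\<close>; the tube lemma, applied on every stage separately, makes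
  \<open>{y. J \<times> {y} \<subseteq> P}\<close> open in the limit.
  Both the \<open>G\<close>-action and the homotopy on the direct limit need this.
\<close>
lemma continuous_map_prod_direct_limit_from:
  assumes Z: "locally_compact_space Z" "Hausdorff_space Z"
    and F: "\<And>n. continuous_map (prod_topology Z (X n)) Y F"
  shows "continuous_map (prod_topology Z (direct_limit_topology X)) Y F"
  unfolding continuous_map_def
proof (intro conjI allI impI)
  let ?L = "direct_limit_topology X"
  show "F \<in> topspace (prod_topology Z ?L) \<rightarrow> topspace Y"
    using continuous_map_funspace[OF F] by (fastforce simp: topspace_direct_limit_topology)
  fix U assume U: "openin Y U"
  define P where "P = {p \<in> topspace (prod_topology Z ?L). F p \<in> U}"
  have P_Int: "openin (prod_topology Z (X n)) (P \<inter> topspace (prod_topology Z (X n)))" for n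
  proof -
    have "P \<inter> topspace (prod_topology Z (X n)) = {p \<in> topspace (prod_topology Z (X n)). F p \<in> U}"
      by (auto simp: P_def topspace_direct_limit_topology)
    then show ?thesis using openin_continuous_map_preimage[OF F U] by simp
  qed
  have "openin (prod_topology Z ?L) P"
    unfolding openin_prod_topology_alt
  proof (intro allI impI)
    fix z x assume zx: "(z, x) \<in> P"
    then obtain n where n: "x \<in> topspace (X n)" and z: "z \<in> topspace Z"
      by (auto simp: P_def topspace_direct_limit_topology)
    with zx have "(z, x) \<in> P \<inter> topspace (prod_topology Z (X n))" by simp
    with P_Int[of n] obtain V V' where V: "openin Z V" "z \<in> V" "x \<in> V'"
        "V \<times> V' \<subseteq> P \<inter> topspace (prod_topology Z (X n))"
      unfolding openin_prod_topology_alt by meson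
    have "neighbourhood_base_of (compactin Z) Z"
      using Z locally_compact_space_neighbourhood_base by blast
    with V(1,2) obtain O' J where J: "openin Z O'" "compactin Z J" "z \<in> O'" "O' \<subseteq> J" "J \<subseteq> V"
      unfolding neighbourhood_base_of by meson
    define W where "W = {y \<in> topspace ?L. J \<times> {y} \<subseteq> P}"
    have "openin (X m) (W \<inter> topspace (X m))" for m
    proof (subst openin_subopen, intro ballI)
      fix y assume y: "y \<in> W \<inter> topspace (X m)"
      have "J \<times> {y} \<subseteq> P \<inter> topspace (prod_topology Z (X m))"
        using y compactin_subset_topspace[OF J(2)] by (auto simp: W_def)
      then obtain A B where AB: "openin (X m) B" "J \<subseteq> A" "y \<in> B"
          "A \<times> B \<subseteq> P \<inter> topspace (prod_topology Z (X m))"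
        using tube_lemma_left[OF P_Int J(2)] y by (metis IntD2)
      then have "B \<subseteq> W \<inter> topspace (X m)"
        using openin_subset[OF AB(1)] by (auto simp: W_def topspace_direct_limit_topology)
      with AB show "\<exists>T. openin (X m) T \<and> y \<in> T \<and> T \<subseteq> W \<inter> topspace (X m)" by blast
    qed
    then have "openin ?L W"
      unfolding openin_direct_limit_topology by (auto simp: W_def topspace_direct_limit_topology)
    moreover have "x \<in> W"
      using V J(5) n by (auto simp: W_def topspace_direct_limit_topology)
    moreover have "O' \<times> W \<subseteq> P"
      using J(4) by (auto simp: W_def)
    ultimately show "\<exists>U V. openin Z U \<and> openin ?L V \<and> z \<in> U \<and> x \<in> V \<and> U \<times> V \<subseteq> P"
      using J by blast
  qed
  then show "openin (prod_topology Z ?L) {p \<in> topspace (prod_topology Z ?L). F p \<in> U}"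
    by (simp add: P_def)
qed

section \<open>Weak* topology\<close>

lemma topspace_weak_star_topology: "topspace (weak_star_topology H) = cpt_measures H"
proof -
  have "\<mu> \<in> \<Union>{{\<nu> \<in> cpt_measures H. \<forall>f\<in>F. \<bar>(\<integral>x. f x \<partial>\<mu>) - (\<integral>x. f x \<partial>\<nu>)\<bar> < \<epsilon>} | \<mu> F \<epsilon>.
          \<mu> \<in> cpt_measures H \<and> finite F \<and> F \<subseteq> cpt_supp_functions H \<and> 0 < \<epsilon>}"
    if "\<mu> \<in> cpt_measures H" for \<mu>
    using that by (intro UnionI[of "cpt_measures H"]) (auto intro!: exI[of _ "{}"] exI[of _ "1::real"])
  then show ?thesis
    unfolding weak_star_topology_def topology_generated_by_topspace by blast
qed

lemma continuous_map_weak_star_integral: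
  assumes f: "f \<in> cpt_supp_functions H"
  shows "continuous_map (weak_star_topology H) euclideanreal (\<lambda>\<mu>. \<integral>x. f x \<partial>\<mu>)"
proof (rule continuous_map_realI)
  fix \<mu> and e :: real assume \<mu>: "\<mu> \<in> topspace (weak_star_topology H)" and e: "e > 0"
  let ?U = "{\<nu> \<in> cpt_measures H. \<forall>f\<in>{f}. \<bar>(\<integral>x. f x \<partial>\<mu>) - (\<integral>x. f x \<partial>\<nu>)\<bar> < e}"
  have "openin (weak_star_topology H) ?U"
    unfolding weak_star_topology_def
  proof (rule topology_generated_by_Basis, intro CollectI exI conjI)
    show "?U = ?U" by (rule refl)
    show "\<mu> \<in> cpt_measures H" using \<mu> by (simp add: topspace_weak_star_topology)
  qed (use f e in auto)
  then show "\<exists>U. openin (weak_star_topology H) U \<and> \<mu> \<in> U \<and>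
      (\<forall>\<nu>\<in>U. \<bar>(\<integral>x. f x \<partial>\<nu>) - (\<integral>x. f x \<partial>\<mu>)\<bar> < e)"
    using \<mu> e by (intro exI[of _ ?U]) (auto simp: topspace_weak_star_topology abs_minus_commute)
qed

lemma continuous_map_into_weak_star:
  assumes "\<And>z. z \<in> topspace Z \<Longrightarrow> p z \<in> cpt_measures H"
    and "\<And>f. f \<in> cpt_supp_functions H \<Longrightarrow> continuous_map Z euclideanreal (\<lambda>z. \<integral>x. f x \<partial>p z)"
  shows "continuous_map Z (weak_star_topology H) p"
  unfolding weak_star_topology_def
proof (rule continuous_on_generated_topo)
  show "p ` topspace Z \<subseteq> \<Union>{{\<nu> \<in> cpt_measures H. \<forall>f\<in>F. \<bar>(\<integral>x. f x \<partial>\<mu>) - (\<integral>x. f x \<partial>\<nu>)\<bar> < \<epsilon>} | \<mu> F \<epsilon>.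
          \<mu> \<in> cpt_measures H \<and> finite F \<and> F \<subseteq> cpt_supp_functions H \<and> 0 < \<epsilon>}"
    using assms(1) topspace_weak_star_topology[of H]
    unfolding weak_star_topology_def topology_generated_by_topspace by blast
next
  fix U
  assume "U \<in> {{\<nu> \<in> cpt_measures H. \<forall>f\<in>F. \<bar>(\<integral>x. f x \<partial>\<mu>) - (\<integral>x. f x \<partial>\<nu>)\<bar> < \<epsilon>} | \<mu> F \<epsilon>.
          \<mu> \<in> cpt_measures H \<and> finite F \<and> F \<subseteq> cpt_supp_functions H \<and> 0 < \<epsilon>}"
  then obtain \<mu> F \<epsilon> where F: "finite F" "F \<subseteq> cpt_supp_functions H"
    and U: "U = {\<nu> \<in> cpt_measures H. \<forall>f\<in>F. \<bar>(\<integral>x. f x \<partial>\<mu>) - (\<integral>x. f x \<partial>\<nu>)\<bar> < \<epsilon>}"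
    by blast
  have "openin Z {z \<in> topspace Z. (\<integral>x. f x \<partial>p z) \<in> {r. \<bar>(\<integral>x. f x \<partial>\<mu>) - r\<bar> < \<epsilon>}}" if "f \<in> F" for f
  proof (rule openin_continuous_map_preimage[OF assms(2)])
    have "open {r. \<bar>(\<integral>x. f x \<partial>\<mu>) - r\<bar> < \<epsilon>}"
      by (intro open_Collect_less continuous_intros)
    then show "openin euclideanreal {r. \<bar>(\<integral>x. f x \<partial>\<mu>) - r\<bar> < \<epsilon>}" by simp
  qed (use that F in blast)
  then have "openin Z (topspace Z \<inter>
      (\<Inter>f\<in>F. {z \<in> topspace Z. (\<integral>x. f x \<partial>p z) \<in> {r. \<bar>(\<integral>x. f x \<partial>\<mu>) - r\<bar> < \<epsilon>}}))"
    using F(1) by (cases "F = {}") (auto intro!: openin_Int openin_INT2)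
  moreover have "p -` U \<inter> topspace Z = topspace Z \<inter>
      (\<Inter>f\<in>F. {z \<in> topspace Z. (\<integral>x. f x \<partial>p z) \<in> {r. \<bar>(\<integral>x. f x \<partial>\<mu>) - r\<bar> < \<epsilon>}})"
    using assms(1) by (auto simp: U)
  ultimately show "openin Z (p -` U \<inter> topspace Z)" by simp
qed

section \<open>Compactly supported measures\<close>

lemma cpt_measures_UNIV_iff:
  "\<mu> \<in> cpt_measures UNIV \<longleftrightarrow> sets \<mu> = sets borel \<and>
     (\<exists>K. compact K \<and> emeasure \<mu> (- K) = 0) \<and> 1/2 < emeasure \<mu> UNIV \<and> emeasure \<mu> UNIV \<le> 1"
proof -
  have "space \<mu> = UNIV" if "sets \<mu> = sets borel"
    using sets_eq_imp_space_eq[OF that] by simp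
  then show ?thesis
    by (auto simp: cpt_measures_def Compl_eq_Diff_UNIV)
qed

lemma ennreal_half: "(1/2 :: ennreal) = ennreal (1/2)"
  by (metis ennreal_1 ennreal_divide_numeral zero_le_one)

lemma
  assumes "\<mu> \<in> cpt_measures UNIV"
  shows sets_cpt_measure: "sets \<mu> = sets borel"
    and space_cpt_measure: "space \<mu> = UNIV"
    and finite_measure_cpt_measure: "finite_measure \<mu>"
    and measure_cpt_measure_gt: "1/2 < measure \<mu> UNIV"
    and measure_cpt_measure_le: "measure \<mu> UNIV \<le> 1"
proof -
  show s: "sets \<mu> = sets borel" using assms by (simp add: cpt_measures_UNIV_iff)
  show sp: "space \<mu> = UNIV" using sets_eq_imp_space_eq[OF s] by simp
  have e: "1/2 < emeasure \<mu> UNIV" "emeasure \<mu> UNIV \<le> 1"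
    using assms by (simp_all add: cpt_measures_UNIV_iff)
  then show "finite_measure \<mu>"
    by (intro finite_measureI) (auto simp: sp top_unique)
  then have m: "emeasure \<mu> UNIV = ennreal (measure \<mu> UNIV)"
    by (rule finite_measure.emeasure_eq_measure)
  show "1/2 < measure \<mu> UNIV"
    using e(1) unfolding m ennreal_half by (subst (asm) ennreal_less_iff) auto
  show "measure \<mu> UNIV \<le> 1" using e(2) unfolding m by simp
qed

lemma cpt_supp_function_bounded:
  assumes "f \<in> cpt_supp_functions UNIV"
  obtains B where "\<And>x. \<bar>f x\<bar> \<le> B"
proof -
  obtain K where K: "compact K" "\<And>x. x \<notin> K \<Longrightarrow> f x = 0" and f: "continuous_on UNIV f"
    using assms by (auto simp: cpt_supp_functions_def)
  have "compact (f ` K)"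
    using K f by (intro compact_continuous_image) (auto intro: continuous_on_subset)
  then obtain B where B: "\<And>x. x \<in> K \<Longrightarrow> \<bar>f x\<bar> \<le> B"
    using compact_imp_bounded bounded_iff by (metis imageI real_norm_def)
  have "\<bar>f x\<bar> \<le> max 0 B" for x
    using B[of x] K(2)[of x] by (cases "x \<in> K") auto
  then show ?thesis by (rule that)
qed

lemma borel_measurable_cpt_measure:
  assumes "\<mu> \<in> cpt_measures UNIV" and "f \<in> borel_measurable borel"
  shows "f \<in> borel_measurable \<mu>"
  using assms measurable_cong_sets[OF sets_cpt_measure[OF assms(1)] refl] by blast

lemma borel_measurable_cpt_supp_function:
  "f \<in> cpt_supp_functions UNIV \<Longrightarrow> f \<in> borel_measurable borel"
  by (auto simp: cpt_supp_functions_def intro: borel_measurable_continuous_onI)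

lemma integrable_bounded_cpt_measure:
  fixes f :: "'a::topological_space \<Rightarrow> real"
  assumes \<mu>: "\<mu> \<in> cpt_measures UNIV" and f: "f \<in> borel_measurable borel" and B: "\<And>x. \<bar>f x\<bar> \<le> B"
  shows "integrable \<mu> f"
proof -
  interpret finite_measure \<mu> using \<mu> by (rule finite_measure_cpt_measure)
  show ?thesis
    by (rule integrable_const_bound[of _ B])
      (use B borel_measurable_cpt_measure[OF \<mu> f] in auto)
qed

lemma integrable_cpt_supp_function:
  assumes "\<mu> \<in> cpt_measures UNIV" and "f \<in> cpt_supp_functions UNIV"
  shows "integrable \<mu> f"
  using cpt_supp_function_bounded[OF assms(2)] assms
  by (metis borel_measurable_cpt_supp_function integrable_bounded_cpt_measure)

lemma integral_bounded_cpt_measure: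
  fixes f :: "'a::topological_space \<Rightarrow> real"
  assumes \<mu>: "\<mu> \<in> cpt_measures UNIV" and f: "integrable \<mu> f" and B: "\<And>x. f x \<le> B" and "0 \<le> B"
  shows "(\<integral>x. f x \<partial>\<mu>) \<le> B"
proof -
  interpret finite_measure \<mu> using \<mu> by (rule finite_measure_cpt_measure)
  have "(\<integral>x. f x \<partial>\<mu>) \<le> (\<integral>x. B \<partial>\<mu>)"
    by (intro integral_mono f B) simp
  also have "\<dots> = measure \<mu> UNIV * B"
    using space_cpt_measure[OF \<mu>] by simp
  also have "\<dots> \<le> B"
    using measure_cpt_measure_le[OF \<mu>] \<open>0 \<le> B\<close> by (simp add: mult_left_le_one_le)
  finally show ?thesis .
qed

text \<open>
  Measures on an open subset can thus be handled as measures on the whole space with support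
  condition, and no further push-forwards along inclusions occur.
\<close>
lemma extend_by_zero_image:
  fixes H :: "'a::t2_space set"
  assumes H: "open H"
  shows "extend_by_zero ` cpt_measures H =
    {\<mu> \<in> cpt_measures UNIV. \<exists>K. compact K \<and> K \<subseteq> H \<and> emeasure \<mu> (- K) = 0}" (is "?L = ?R")
proof (intro subset_antisym subsetI)
  fix \<nu> assume "\<nu> \<in> ?L"
  then obtain \<mu> where \<mu>: "\<mu> \<in> cpt_measures H" and \<nu>: "\<nu> = distr \<mu> borel (\<lambda>x. x)"
    by (auto simp: extend_by_zero_def)
  have s: "sets \<mu> = sets (restrict_space borel H)" and sp: "space \<mu> = H"
    using \<mu> sets_eq_imp_space_eq[of \<mu> "restrict_space borel H"]
    by (auto simp: cpt_measures_def space_restrict_space)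
  have "(\<lambda>x. x) \<in> measurable (restrict_space borel H) borel"
    by (rule measurable_restrict_space1) simp
  then have m: "(\<lambda>x. x) \<in> measurable \<mu> borel"
    using measurable_cong_sets[OF s refl] by blast
  have em: "emeasure \<nu> A = emeasure \<mu> (A \<inter> H)" if "A \<in> sets borel" for A
    unfolding \<nu> using that m by (simp add: emeasure_distr sp)
  obtain K where K: "compact K" "K \<subseteq> H" "emeasure \<mu> (H - K) = 0"
    using \<mu> by (auto simp: cpt_measures_def)
  have "- K \<inter> H = H - K" by blast
  then have K': "emeasure \<nu> (- K) = 0"
    using em[of "- K"] K by (simp add: compact_imp_closed)
  have "emeasure \<nu> UNIV = emeasure \<mu> H" using em[of UNIV] by simp
  moreover have "sets \<nu> = sets borel" by (simp add: \<nu>)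
  ultimately have "\<nu> \<in> cpt_measures UNIV"
    using K(1) K' \<mu> unfolding cpt_measures_UNIV_iff by (auto simp: cpt_measures_def sp)
  with K K' show "\<nu> \<in> ?R" by blast
next
  fix \<nu> assume "\<nu> \<in> ?R"
  then obtain K where \<nu>: "\<nu> \<in> cpt_measures UNIV" and K: "compact K" "K \<subseteq> H" "emeasure \<nu> (- K) = 0"
    by blast
  note s = sets_cpt_measure[OF \<nu>] and sp = space_cpt_measure[OF \<nu>]
  define \<mu> where "\<mu> = restrict_space \<nu> H"
  have HB: "H \<in> sets borel" using H by simp
  have s\<mu>: "sets \<mu> = sets (restrict_space borel H)"
    unfolding \<mu>_def by (rule sets_restrict_space_cong) (rule s)
  have sp\<mu>: "space \<mu> = H" by (simp add: \<mu>_def space_restrict_space sp)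
  have em: "emeasure \<mu> A = emeasure \<nu> A" if "A \<subseteq> H" for A
    unfolding \<mu>_def using that HB by (intro emeasure_restrict_space) (auto simp: s sp)
  have KB: "- K \<in> sets \<nu>" using K(1) by (simp add: s compact_imp_closed)
  have null: "emeasure \<nu> A = 0" if "A \<subseteq> - K" for A
    using emeasure_mono[OF that KB] K(3) by simp
  have ext: "emeasure \<nu> (A \<inter> H) = emeasure \<nu> A" if "A \<in> sets borel" for A
  proof -
    have "emeasure \<nu> A = emeasure \<nu> (A \<inter> H) + emeasure \<nu> (A - H)"
      using that HB s by (subst plus_emeasure) (auto simp: Int_Diff_Un)
    moreover have "emeasure \<nu> (A - H) = 0" using K(2) by (intro null) auto
    ultimately show ?thesis by simp
  qed
  have "(\<lambda>x. x) \<in> measurable (restrict_space borel H) borel"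
    by (rule measurable_restrict_space1) simp
  then have m: "(\<lambda>x. x) \<in> measurable \<mu> borel"
    using measurable_cong_sets[OF s\<mu> refl] by blast
  have "extend_by_zero \<mu> = \<nu>"
  proof (rule measure_eqI)
    show "sets (extend_by_zero \<mu>) = sets \<nu>" by (simp add: extend_by_zero_def s)
    fix A assume "A \<in> sets (extend_by_zero \<mu>)"
    then have A: "A \<in> sets borel" by (simp add: extend_by_zero_def)
    show "emeasure (extend_by_zero \<mu>) A = emeasure \<nu> A"
      using A m by (simp add: extend_by_zero_def emeasure_distr sp\<mu> em ext)
  qed
  moreover have "\<mu> \<in> cpt_measures H"
  proof -
    have "emeasure \<mu> (H - K) = 0" using em[of "H - K"] null[of "H - K"] by auto
    moreover have "emeasure \<mu> H = emeasure \<nu> UNIV" using em[of H] ext[of UNIV] by simp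
    ultimately show ?thesis
      using \<nu>[unfolded cpt_measures_UNIV_iff] K(1,2) s\<mu> unfolding cpt_measures_def
      by (auto simp: sp\<mu>)
  qed
  ultimately show "\<nu> \<in> ?L" by blast
qed

section \<open>Open subgroups and their cosets\<close>

lemma
  assumes "subgroup_add H"
  shows subgroup_add_zero: "0 \<in> H"
    and subgroup_add_add: "x \<in> H \<Longrightarrow> y \<in> H \<Longrightarrow> x + y \<in> H"
    and subgroup_add_minus: "x \<in> H \<Longrightarrow> - x \<in> H"
  using assms by (auto simp: subgroup_add_def)

lemma open_coset:
  fixes H :: "'a::topological_group_add set"
  assumes "open H"
  shows "open {y. - x + y \<in> H}"
proof -
  have "continuous_on UNIV (\<lambda>y. - x + y)" by (intro continuous_intros)
  then have "open ((\<lambda>y. - x + y) -` H)" using assms by (rule open_vimage[rotated])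
  then show ?thesis by (simp add: vimage_def)
qed

lemma closed_open_subgroup:
  fixes H :: "'a::topological_group_add set"
  assumes H: "subgroup_add H" "open H"
  shows "closed H"
proof -
  have "- H = (\<Union>x\<in>- H. {y. - x + y \<in> H})"
  proof (intro subset_antisym subsetI)
    fix y assume "y \<in> - H"
    then show "y \<in> (\<Union>x\<in>- H. {y. - x + y \<in> H})"
      using subgroup_add_zero[OF H(1)] by (intro UN_I[of y]) auto
  next
    fix y assume "y \<in> (\<Union>x\<in>- H. {y. - x + y \<in> H})"
    then obtain x where x: "x \<notin> H" "- x + y \<in> H" by auto
    show "y \<in> - H"
    proof
      assume "y \<in> H"
      then have "y + - (- x + y) \<in> H"
        using x(2) H(1) by (blast intro: subgroup_add_add subgroup_add_minus)
      then show False using x(1) by (simp add: minus_add)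
    qed
  qed
  also have "open \<dots>" using open_coset[OF H(2)] by blast
  finally show ?thesis by (simp add: closed_def)
qed

lemma closed_coset:
  fixes H :: "'a::topological_group_add set"
  assumes "closed H"
  shows "closed {y. - x + y \<in> H}"
proof -
  have "open {y. - x + y \<in> - H}" using assms by (intro open_coset) (simp add: open_Compl)
  moreover have "{y. - x + y \<in> - H} = - {y. - x + y \<in> H}" by auto
  ultimately show ?thesis by (simp add: closed_def)
qed

lemma continuous_on_indicator_mult:
  fixes f :: "'a::topological_space \<Rightarrow> real"
  assumes f: "continuous_on UNIV f" and C: "open C" "closed C"
  shows "continuous_on UNIV (\<lambda>y. indicator C y * f y)"
proof -
  have "continuous_on (C \<union> - C) (\<lambda>y. if y \<in> C then f y else 0)"
    using C by (intro continuous_on_If) (auto intro: continuous_on_subset[OF f] simp: closed_Compl)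
  then have "continuous_on UNIV (\<lambda>y. if y \<in> C then f y else 0)" by simp
  then show ?thesis by (rule continuous_on_eq) auto
qed

lemma cpt_supp_function_indicator_mult:
  assumes f: "f \<in> cpt_supp_functions UNIV" and C: "open C" "closed C"
  shows "(\<lambda>y. indicator C y * f y) \<in> cpt_supp_functions UNIV"
proof -
  obtain K where K: "compact K" "\<And>x. x \<notin> K \<Longrightarrow> f x = 0" and cf: "continuous_on UNIV f"
    using f by (auto simp: cpt_supp_functions_def)
  then have "\<forall>x\<in>UNIV - K. indicator C x * f x = 0" by simp
  with K(1) continuous_on_indicator_mult[OF cf C] show ?thesis
    unfolding cpt_supp_functions_def by blast
qed

text \<open>
  A function that is constant on the cosets of an open subgroup is locally constant.
\<close>
lemma borel_measurable_coset_invariant: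
  fixes k :: "'a::{topological_group_add, second_countable_topology} \<Rightarrow> real"
  assumes H: "subgroup_add H" "open H"
    and k: "\<And>x h. h \<in> H \<Longrightarrow> k (x + h) = k x"
  shows "k \<in> borel_measurable borel"
proof (rule borel_measurableI)
  fix S :: "real set" assume "open S"
  have "open (k -` S)"
  proof (subst open_subopen, intro ballI)
    fix x assume x: "x \<in> k -` S"
    have "k y = k x" if "- x + y \<in> H" for y
      using k[OF that, of x] by (simp add: add.assoc[symmetric])
    then have "{y. - x + y \<in> H} \<subseteq> k -` S" using x by auto
    moreover have "x \<in> {y. - x + y \<in> H}" using subgroup_add_zero[OF H(1)] by simp
    ultimately show "\<exists>T. open T \<and> x \<in> T \<and> T \<subseteq> k -` S"
      using open_coset[OF H(2)] by blast
  qed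
  then show "k -` S \<inter> space borel \<in> sets borel" by simp
qed

text \<open>
  This is what makes a weight that depends on the measure harmless: the compact support of the
  test function \<open>f\<close> meets only finitely many cosets of \<open>H\<close>, and the weight is constant on each of
  them, so the integral is a finite sum of products of continuous functions. In particular
  continuity of \<open>k z x\<close> in \<open>z\<close> for every single \<open>x\<close> suffices.
\<close>
lemma continuous_map_coset_weighted_integral:
  fixes H :: "'a::{topological_group_add, second_countable_topology, t2_space} set"
  assumes H: "subgroup_add H" "open H"
    and p: "continuous_map Z (weak_star_topology UNIV) p"
    and k: "\<And>x. continuous_map Z euclideanreal (\<lambda>z. k z x)"
    and inv: "\<And>z x h. h \<in> H \<Longrightarrow> k z (x + h) = k z x"
    and f: "f \<in> cpt_supp_functions UNIV"
  shows "continuous_map Z euclideanreal (\<lambda>z. \<integral>y. k z y * f y \<partial>p z)"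
proof -
  define coset where "coset x = {y. - x + y \<in> H}" for x
  have self: "x \<in> coset x" for x
    using subgroup_add_zero[OF H(1)] by (simp add: coset_def)
  have coset_eq: "coset x = coset z" if y: "y \<in> coset x" "y \<in> coset z" for x y z
  proof -
    have step: "w \<in> coset c" if w: "w \<in> coset b" and v: "v \<in> coset b" "v \<in> coset c" for b c v w
    proof -
      have "(- c + v) + (- (- b + v) + (- b + w)) \<in> H"
        using w v H(1) unfolding coset_def
        by (auto intro!: subgroup_add_add subgroup_add_minus)
      then show ?thesis by (simp add: coset_def minus_add add.assoc)
    qed
    show ?thesis using step y by blast
  qed
  have k_coset: "k z y = k z x" if "y \<in> coset x" for x y z
    using inv[of "- x + y" z x] that by (simp add: coset_def add.assoc[symmetric])
  obtain K where K: "compact K" "\<And>x. x \<notin> K \<Longrightarrow> f x = 0"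
    using f by (auto simp: cpt_supp_functions_def)
  have open_cosets: "open (coset x)" for x unfolding coset_def by (rule open_coset[OF H(2)])
  have "K \<subseteq> (\<Union>x\<in>K. coset x)" using self by blast
  then obtain D where "D \<subseteq> K" and D: "finite D" "K \<subseteq> (\<Union>x\<in>D. coset x)"
    by (rule compactE_image[OF K(1) open_cosets])
  define pick where "pick C = (SOME x. x \<in> C)" for C :: "'a set"
  have pick: "pick (coset x) \<in> coset x" for x
    unfolding pick_def using self[of x] by (rule someI)
  have decomp: "k z y * f y = (\<Sum>C\<in>coset ` D. k z (pick C) * (indicator C y * f y))" for z y
  proof (cases "y \<in> K")
    case False
    then show ?thesis by (simp add: K(2))
  next
    case True
    then obtain x where x: "x \<in> D" "y \<in> coset x" using D(2) by blast
    have "(\<Sum>C\<in>coset ` D. k z (pick C) * (indicator C y * f y))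
        = (\<Sum>C\<in>{coset x}. k z (pick C) * (indicator C y * f y))"
    proof (rule sum.mono_neutral_right)
      show "\<forall>C\<in>coset ` D - {coset x}. k z (pick C) * (indicator C y * f y) = 0"
        using coset_eq[OF x(2)] by (auto simp: indicator_def)
    qed (use D(1) x(1) in auto)
    also have "\<dots> = k z y * f y"
      using x(2) k_coset[OF pick, of z x] k_coset[OF x(2), of z] by simp
    finally show ?thesis by simp
  qed
  have cf: "(\<lambda>y. indicator (coset x) y * f y) \<in> cpt_supp_functions UNIV" for x
    unfolding coset_def
    by (intro cpt_supp_function_indicator_mult f open_coset closed_coset H closed_open_subgroup)
  have eq: "(\<integral>y. k z y * f y \<partial>p z) = (\<Sum>C\<in>coset ` D. k z (pick C) * (\<integral>y. indicator C y * f y \<partial>p z))"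
    if "z \<in> topspace Z" for z
  proof -
    have pz: "p z \<in> cpt_measures UNIV"
      using continuous_map_funspace[OF p] that by (auto simp: topspace_weak_star_topology)
    have "(\<integral>y. k z y * f y \<partial>p z)
        = (\<integral>y. (\<Sum>C\<in>coset ` D. k z (pick C) * (indicator C y * f y)) \<partial>p z)"
      by (simp only: decomp)
    also have "\<dots> = (\<Sum>C\<in>coset ` D. \<integral>y. k z (pick C) * (indicator C y * f y) \<partial>p z)"
      by (intro Bochner_Integration.integral_sum integrable_mult_right)
        (auto intro!: integrable_cpt_supp_function[OF pz] cf)
    finally show ?thesis by simp
  qed
  have "continuous_map Z euclideanreal
      (\<lambda>z. \<Sum>C\<in>coset ` D. k z (pick C) * (\<integral>y. indicator C y * f y \<partial>p z))"
  proof (intro continuous_map_sum continuous_map_real_mult k)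
    fix C assume "C \<in> coset ` D"
    then have "(\<lambda>y. indicator C y * f y) \<in> cpt_supp_functions UNIV" using cf by blast
    from continuous_map_compose[OF p continuous_map_weak_star_integral[OF this]]
    show "continuous_map Z euclideanreal (\<lambda>z. \<integral>y. indicator C y * f y \<partial>p z)"
      by (simp add: o_def)
  qed (use D(1) in simp)
  then show ?thesis by (rule continuous_map_eq) (simp add: eq)
qed

section \<open>Translation of measures\<close>

lemma borel_measurable_translation:
  "(\<lambda>x. g + x :: 'a::topological_group_add) \<in> borel_measurable borel"
  by (intro borel_measurable_continuous_onI continuous_intros)

lemma measurable_translation_cpt_measure:
  fixes \<mu> :: "'a::topological_group_add measure"
  assumes "\<mu> \<in> cpt_measures UNIV"
  shows "(\<lambda>x. g + x) \<in> measurable \<mu> borel"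
  using assms borel_measurable_cpt_measure[OF assms] borel_measurable_translation
    measurable_cong_sets[OF sets_cpt_measure[OF assms] refl] by blast

lemma left_translate_support:
  fixes \<mu> :: "'a::{topological_group_add, t2_space} measure"
  assumes \<mu>: "\<mu> \<in> cpt_measures UNIV" and K: "compact K" "emeasure \<mu> (- K) = 0"
  shows "compact ((+) g ` K)" "emeasure (left_translate g \<mu>) (- (+) g ` K) = 0"
proof -
  show c: "compact ((+) g ` K)"
    using K(1) by (intro compact_continuous_image continuous_intros)
  have "(\<lambda>x. g + x) -` (- (+) g ` K) \<inter> space \<mu> = - K"
    using space_cpt_measure[OF \<mu>] by auto
  then show "emeasure (left_translate g \<mu>) (- (+) g ` K) = 0"
    unfolding left_translate_def
    using K c measurable_translation_cpt_measure[OF \<mu>]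
    by (subst emeasure_distr) (auto dest: compact_imp_closed)
qed

lemma cpt_measure_left_translate:
  fixes \<mu> :: "'a::{topological_group_add, t2_space} measure"
  assumes \<mu>: "\<mu> \<in> cpt_measures UNIV"
  shows "left_translate g \<mu> \<in> cpt_measures UNIV"
proof -
  obtain K where K: "compact K" "emeasure \<mu> (- K) = 0"
    using \<mu> by (auto simp: cpt_measures_UNIV_iff)
  have "emeasure (left_translate g \<mu>) UNIV = emeasure \<mu> UNIV"
    unfolding left_translate_def using measurable_translation_cpt_measure[OF \<mu>]
    by (simp add: emeasure_distr space_cpt_measure[OF \<mu>])
  moreover have "sets (left_translate g \<mu>) = sets borel" by (simp add: left_translate_def)
  ultimately show ?thesis
    using left_translate_support[OF \<mu> K] \<mu> unfolding cpt_measures_UNIV_iff by auto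
qed

lemma integral_left_translate:
  fixes \<mu> :: "'a::topological_group_add measure" and f :: "'a \<Rightarrow> real"
  assumes "\<mu> \<in> cpt_measures UNIV" and "f \<in> borel_measurable borel"
  shows "(\<integral>x. f x \<partial>left_translate g \<mu>) = (\<integral>x. f (g + x) \<partial>\<mu>)"
  unfolding left_translate_def
  by (rule integral_distr) (use assms measurable_translation_cpt_measure in auto)

lemma left_translate_zero:
  fixes \<mu> :: "'a::topological_group_add measure"
  assumes \<mu>: "\<mu> \<in> cpt_measures UNIV"
  shows "left_translate 0 \<mu> = \<mu>"
proof -
  have "(+) 0 = (\<lambda>x :: 'a. x)" by (rule ext) simp
  then show ?thesis
    unfolding left_translate_def using distr_id2[of borel \<mu>] sets_cpt_measure[OF \<mu>] by simp
qed

lemma left_translate_add: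
  fixes \<mu> :: "'a::topological_group_add measure"
  assumes \<mu>: "\<mu> \<in> cpt_measures UNIV"
  shows "left_translate (g + h) \<mu> = left_translate g (left_translate h \<mu>)"
proof -
  have "(+) (g + h) = (+) g \<circ> (+) h" by (rule ext) (simp add: add.assoc)
  then show ?thesis
    unfolding left_translate_def
    by (simp add: distr_distr borel_measurable_translation measurable_translation_cpt_measure[OF \<mu>])
qed

lemma cpt_supp_function_translate:
  fixes f :: "'a::topological_group_add \<Rightarrow> real"
  assumes f: "f \<in> cpt_supp_functions UNIV"
  shows "(\<lambda>x. f (g + x)) \<in> cpt_supp_functions UNIV"
proof -
  obtain K where K: "compact K" "\<And>x. x \<notin> K \<Longrightarrow> f x = 0" and cf: "continuous_on UNIV f"
    using f by (auto simp: cpt_supp_functions_def)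
  have "continuous_on UNIV (\<lambda>x. f (g + x))"
    by (intro continuous_on_compose2[OF cf] continuous_intros) auto
  moreover have "compact ((+) (- g) ` K)"
    using K(1) by (intro compact_continuous_image continuous_intros)
  moreover have "f (g + x) = 0" if "x \<notin> (+) (- g) ` K" for x
  proof (rule K(2))
    show "g + x \<notin> K"
    proof
      assume "g + x \<in> K"
      then have "- g + (g + x) \<in> (+) (- g) ` K" by blast
      with that show False by (simp add: add.assoc[symmetric])
    qed
  qed
  ultimately show ?thesis unfolding cpt_supp_functions_def by blast
qed

lemma locally_compact_nbhd:
  fixes x :: "'a::t2_space"
  assumes "locally_compact_space (euclidean :: 'a topology)"
  obtains V K where "open V" "x \<in> V" "V \<subseteq> K" "compact K"
proof -
  have "\<exists>U. open U \<and> (\<exists>K. compact K \<and> x \<in> U \<and> U \<subseteq> K)"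
    using assms by (auto simp: locally_compact_space_def)
  with that show ?thesis by blast
qed

text \<open>
  For \<open>g\<close> in a compact neighbourhood of \<open>g\<^sub>0\<close>, the translates of \<open>f\<close> vanish off one common compact
  set \<open>L\<close>, and on \<open>L\<close> uniformity is the tube lemma.
\<close>
lemma cpt_supp_function_translate_uniform:
  fixes f :: "'a::{topological_group_add, t2_space} \<Rightarrow> real"
  assumes lc: "locally_compact_space (euclidean :: 'a topology)"
    and f: "f \<in> cpt_supp_functions UNIV" and e: "e > 0"
  obtains U where "open U" "g\<^sub>0 \<in> U" "\<And>g x. g \<in> U \<Longrightarrow> \<bar>f (g + x) - f (g\<^sub>0 + x)\<bar> \<le> e"
proof -
  obtain S where S: "compact S" "\<And>x. x \<notin> S \<Longrightarrow> f x = 0" and cf: "continuous_on UNIV f"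
    using f by (auto simp: cpt_supp_functions_def)
  obtain V K where V: "open V" "g\<^sub>0 \<in> V" "V \<subseteq> K" "compact K"
    using locally_compact_nbhd[OF lc] by blast
  define L where "L = (\<lambda>(g, s). - g + s) ` (K \<times> S)"
  have L: "compact L"
    unfolding L_def split_def
    by (intro compact_continuous_image compact_Times V S continuous_intros)
  have "continuous_on (UNIV \<times> L) (\<lambda>(g, x). f (g + x))"
    unfolding split_def by (intro continuous_on_compose2[OF cf] continuous_intros) auto
  from this L UNIV_I e
  obtain X where "g\<^sub>0 \<in> X" "open X" "\<forall>g\<in>X \<inter> UNIV. \<forall>x\<in>L.
      dist (case (g, x) of (g, x) \<Rightarrow> f (g + x)) (case (g\<^sub>0, x) of (g, x) \<Rightarrow> f (g + x)) \<le> e"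
    by (rule continuous_on_prod_compactE)
  then have X: "g\<^sub>0 \<in> X" "open X" "\<forall>g\<in>X. \<forall>x\<in>L. dist (f (g + x)) (f (g\<^sub>0 + x)) \<le> e"
    by simp_all
  show ?thesis
  proof (rule that[of "V \<inter> X"])
    fix g x assume g: "g \<in> V \<inter> X"
    show "\<bar>f (g + x) - f (g\<^sub>0 + x)\<bar> \<le> e"
    proof (cases "x \<in> L")
      case True
      with X(3) g show ?thesis by (auto simp: dist_real_def)
    next
      case False
      have "f (h + x) = 0" if "h \<in> K" for h
      proof (rule S(2), rule notI)
        assume "h + x \<in> S"
        then have "- h + (h + x) \<in> L" using that unfolding L_def by force
        with False show False by (simp add: add.assoc[symmetric])
      qed
      then have "f (g + x) = 0" "f (g\<^sub>0 + x) = 0" using g V(2,3) by blast+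
      with e show ?thesis by simp
    qed
  qed (use V X in auto)
qed

text \<open>
  Joint continuity: total masses are at most \<open>1\<close>, so a uniformly small change of the test function
  changes the integral little, uniformly in the measure.
\<close>
lemma continuous_map_translate_integral:
  fixes f :: "'a::{topological_group_add, second_countable_topology, t2_space} \<Rightarrow> real"
  assumes lc: "locally_compact_space (euclidean :: 'a topology)"
    and f: "f \<in> cpt_supp_functions UNIV"
  shows "continuous_map (prod_topology euclidean (weak_star_topology UNIV)) euclideanreal
           (\<lambda>(g, \<mu>). \<integral>x. f (g + x) \<partial>\<mu>)"
proof (rule continuous_map_realI, clarify)
  fix g\<^sub>0 :: 'a and \<mu>\<^sub>0 :: "'a measure" and e :: real
  assume "(g\<^sub>0, \<mu>\<^sub>0) \<in> topspace (prod_topology euclidean (weak_star_topology UNIV))" and e: "e > 0"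
  then have \<mu>\<^sub>0: "\<mu>\<^sub>0 \<in> topspace (weak_star_topology UNIV)" by simp
  let ?W = "weak_star_topology UNIV :: 'a measure topology"
  obtain U where U: "open U" "g\<^sub>0 \<in> U" "\<And>g x. g \<in> U \<Longrightarrow> \<bar>f (g + x) - f (g\<^sub>0 + x)\<bar> \<le> e/2"
    using cpt_supp_function_translate_uniform[OF lc f, of "e/2"] e by auto
  let ?c = "\<integral>x. f (g\<^sub>0 + x) \<partial>\<mu>\<^sub>0"
  let ?V = "{\<mu> \<in> topspace ?W. (\<integral>x. f (g\<^sub>0 + x) \<partial>\<mu>) \<in> ball ?c (e/2)}"
  have V: "openin ?W ?V"
    by (rule openin_continuous_map_preimage
        [OF continuous_map_weak_star_integral[OF cpt_supp_function_translate[OF f]]]) simp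
  have "\<bar>(\<integral>x. f (g + x) \<partial>\<mu>) - ?c\<bar> < e" if "g \<in> U" "\<mu> \<in> ?V" for g \<mu>
  proof -
    have \<mu>: "\<mu> \<in> cpt_measures UNIV" using that by (simp add: topspace_weak_star_topology)
    have i: "integrable \<mu> (\<lambda>x. f (h + x))" for h
      by (intro integrable_cpt_supp_function \<mu> cpt_supp_function_translate f)
    have "\<bar>(\<integral>x. f (g + x) \<partial>\<mu>) - (\<integral>x. f (g\<^sub>0 + x) \<partial>\<mu>)\<bar> = \<bar>\<integral>x. f (g + x) - f (g\<^sub>0 + x) \<partial>\<mu>\<bar>"
      by (simp add: i)
    also have "\<dots> \<le> (\<integral>x. \<bar>f (g + x) - f (g\<^sub>0 + x)\<bar> \<partial>\<mu>)"
      by (rule integral_abs_bound)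
    also have "\<dots> \<le> e/2"
      using e U(3)[OF that(1)]
      by (intro integral_bounded_cpt_measure[OF \<mu>] integrable_abs Bochner_Integration.integrable_diff i) auto
    finally have "\<bar>(\<integral>x. f (g + x) \<partial>\<mu>) - (\<integral>x. f (g\<^sub>0 + x) \<partial>\<mu>)\<bar> \<le> e/2" .
    moreover have "\<bar>?c - (\<integral>x. f (g\<^sub>0 + x) \<partial>\<mu>)\<bar> < e/2"
      using that(2) by (simp add: dist_real_def)
    ultimately show ?thesis by linarith
  qed
  moreover have "openin (prod_topology euclidean ?W) (U \<times> ?V)"
    using U(1) V by (simp add: openin_prod_Times_iff)
  moreover have "(g\<^sub>0, \<mu>\<^sub>0) \<in> U \<times> ?V" using U \<mu>\<^sub>0 e by simp
  ultimately show "\<exists>U. openin (prod_topology euclidean ?W) U \<and> (g\<^sub>0, \<mu>\<^sub>0) \<in> U \<and>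
      (\<forall>y\<in>U. \<bar>(case y of (g, \<mu>) \<Rightarrow> \<integral>x. f (g + x) \<partial>\<mu>) - (\<integral>x. f (g\<^sub>0 + x) \<partial>\<mu>\<^sub>0)\<bar> < e)"
    by (intro exI[of _ "U \<times> ?V"]) auto
qed

lemma G_space_weak_star:
  assumes lc: "locally_compact_space
      (euclidean :: 'a::{topological_group_add, second_countable_topology, t2_space} topology)"
  shows "G_space (weak_star_topology (UNIV :: 'a set)) left_translate"
  unfolding G_space_def
proof (intro conjI ballI allI)
  show "continuous_map (prod_topology euclidean (weak_star_topology (UNIV :: 'a set)))
     (weak_star_topology UNIV) (\<lambda>(g, x). left_translate g x)"
  proof (rule continuous_map_into_weak_star)
    fix f :: "'a \<Rightarrow> real" assume f: "f \<in> cpt_supp_functions UNIV"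
    show "continuous_map (prod_topology euclidean (weak_star_topology UNIV)) euclideanreal
        (\<lambda>z. \<integral>x. f x \<partial>(case z of (g, x) \<Rightarrow> left_translate g x))"
      by (rule continuous_map_eq[OF continuous_map_translate_integral[OF lc f]])
        (auto simp: integral_left_translate topspace_weak_star_topology
          borel_measurable_cpt_supp_function[OF f])
  qed (auto simp: topspace_weak_star_topology cpt_measure_left_translate)
qed (auto simp: topspace_weak_star_topology left_translate_zero left_translate_add)

section \<open>Cutoff functions\<close>

lemma Hausdorff_space_t2: "Hausdorff_space (euclidean :: 'a::t2_space topology)"
  unfolding Hausdorff_space_def disjnt_def by simp (metis hausdorff)

text \<open>
  Locally compact Hausdorff spaces are completely regular.
\<close>
lemma cpt_supp_bump:
  fixes x :: "'a::t2_space"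
  assumes lc: "locally_compact_space (euclidean :: 'a topology)"
  obtains c :: "'a \<Rightarrow> real" where "c \<in> cpt_supp_functions UNIV" "\<And>y. 0 \<le> c y" "0 < c x"
proof -
  obtain V K where V: "open V" "x \<in> V" "V \<subseteq> K" "compact K"
    using locally_compact_nbhd[OF lc] by blast
  have "completely_regular_space (euclidean :: 'a topology)"
    using lc by (intro locally_compact_regular_imp_completely_regular_space disjI1)
      (simp_all add: Hausdorff_space_t2)
  moreover have "closedin euclidean (- V)" using V(1) by (simp add: closed_Compl)
  ultimately obtain u :: "'a \<Rightarrow> real" where u: "continuous_map euclidean (top_of_set {0..1}) u"
      "u x = 0" "u ` (- V) \<subseteq> {1}"
    unfolding completely_regular_space_def using V(2) by force
  have cu: "continuous_on UNIV u" and u01: "\<And>y. u y \<in> {0..1}"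
    using u(1) by (auto simp: continuous_map_in_subtopology)
  show ?thesis
  proof (rule that[of "\<lambda>y. 1 - u y"])
    have "\<forall>y\<in>UNIV - K. 1 - u y = 0" using u(3) V(3) by auto
    moreover have "continuous_on UNIV (\<lambda>y. 1 - u y)" by (intro continuous_intros cu)
    ultimately show "(\<lambda>y. 1 - u y) \<in> cpt_supp_functions UNIV"
      using V(4) unfolding cpt_supp_functions_def by blast
  qed (use u01 u(2) in auto)
qed

lemma cpt_supp_functions_zero: "(\<lambda>x. 0) \<in> cpt_supp_functions H"
  by (auto simp: cpt_supp_functions_def intro!: exI[of _ "{}"])

lemma cpt_supp_functions_add:
  assumes "f \<in> cpt_supp_functions H" "g \<in> cpt_supp_functions H"
  shows "(\<lambda>x. f x + g x) \<in> cpt_supp_functions H"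
proof -
  obtain K L where "compact K" "K \<subseteq> H" "\<forall>x\<in>H - K. f x = 0" "compact L" "L \<subseteq> H" "\<forall>x\<in>H - L. g x = 0"
      "continuous_on H f" "continuous_on H g"
    using assms by (auto simp: cpt_supp_functions_def)
  then show ?thesis
    unfolding cpt_supp_functions_def
    by (intro CollectI conjI continuous_on_add exI[of _ "K \<union> L"]) auto
qed

lemma cpt_supp_functions_sum:
  "(\<And>i. i \<in> I \<Longrightarrow> f i \<in> cpt_supp_functions H) \<Longrightarrow> (\<lambda>x. \<Sum>i\<in>I. f i x) \<in> cpt_supp_functions H"
  by (induction I rule: infinite_finite_induct)
    (auto intro: cpt_supp_functions_add cpt_supp_functions_zero)

text \<open>
  Countably many bumps have positivity sets covering the group (Lindelof). Scaling their partial
  sums by \<open>n\<close> and truncating at \<open>1\<close> gives test functions that are eventually \<open>1\<close> at each point;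
  multiplying with the indicator of the open and closed set \<open>G n\<close> forces the support into \<open>G n\<close>.
\<close>
lemma exhausting_cutoffs:
  fixes G :: "nat \<Rightarrow> 'a::{topological_group_add, second_countable_topology, t2_space} set"
  assumes lc: "locally_compact_space (euclidean :: 'a topology)"
    and G: "\<And>n. subgroup_add (G n)" "\<And>n. open (G n)" "incseq G" "(\<Union>n. G n) = UNIV"
  obtains \<phi> :: "nat \<Rightarrow> 'a \<Rightarrow> real"
  where "\<And>n. \<phi> n \<in> cpt_supp_functions UNIV" "\<And>n x. 0 \<le> \<phi> n x" "\<And>n x. \<phi> n x \<le> 1"
    "\<And>n x. \<phi> n x \<noteq> 0 \<Longrightarrow> x \<in> G n" "\<And>x. (\<lambda>n. \<phi> n x) \<longlonglongrightarrow> 1"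
proof -
  obtain b :: "'a \<Rightarrow> 'a \<Rightarrow> real"
    where b: "\<And>x. b x \<in> cpt_supp_functions UNIV" "\<And>x y. 0 \<le> b x y" "\<And>x. 0 < b x x"
  proof -
    have "\<exists>c. c \<in> cpt_supp_functions UNIV \<and> (\<forall>y. 0 \<le> c y) \<and> 0 < c x" for x :: 'a
      using cpt_supp_bump[OF lc, of x] by metis
    then show ?thesis using that by metis
  qed
  have "open {y. 0 < b x y}" for x
    using b(1)[of x] by (intro open_Collect_less) (auto simp: cpt_supp_functions_def)
  then have "\<And>S. S \<in> range (\<lambda>x. {y. 0 < b x y}) \<Longrightarrow> open S" by blast
  then obtain \<U> where U: "\<U> \<subseteq> range (\<lambda>x. {y. 0 < b x y})" "countable \<U>"
      "\<Union>\<U> = (\<Union>x. {y. 0 < b x y})"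
    by (rule Lindelof)
  obtain D where D: "countable D" "\<U> = (\<lambda>x. {y. 0 < b x y}) ` D"
    using U(1,2) by (metis countable_subset_image)
  have cover: "\<exists>x\<in>D. 0 < b x y" for y
    using U(3) b(3)[of y] D(2) by blast
  then have "D \<noteq> {}" by blast
  define c where "c i = b (from_nat_into D i)" for i
  have c_pos: "\<exists>i. 0 < c i y" for y
    using cover[of y] D(1) unfolding c_def by (metis from_nat_into_surj)
  have c: "c i \<in> cpt_supp_functions UNIV" "0 \<le> c i y" for i y
    using b by (auto simp: c_def)
  \<comment> \<open>The factor \<open>n\<close> brings \<open>s n y\<close> up to \<open>1\<close> as soon as one bump is positive at \<open>y\<close>.\<close>
  define s where "s n y = min 1 (real n * (\<Sum>i<n. c i y))" for n y
  have s: "s n \<in> cpt_supp_functions UNIV" for n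
  proof -
    have "(\<lambda>y. \<Sum>i<n. c i y) \<in> cpt_supp_functions UNIV"
      by (intro cpt_supp_functions_sum c)
    then obtain K where K: "compact K" "\<forall>y\<in>UNIV - K. (\<Sum>i<n. c i y) = 0"
        and cont: "continuous_on UNIV (\<lambda>y. \<Sum>i<n. c i y)"
      unfolding cpt_supp_functions_def by blast
    have "continuous_on UNIV (s n)"
      unfolding s_def by (intro continuous_intros cont)
    moreover have "\<forall>y\<in>UNIV - K. s n y = 0" using K(2) by (simp add: s_def)
    ultimately show ?thesis using K(1) unfolding cpt_supp_functions_def by blast
  qed
  have s01: "0 \<le> s n y" "s n y \<le> 1" for n y
    by (auto simp: s_def intro!: sum_nonneg mult_nonneg_nonneg c)
  show ?thesis
  proof (rule that[of "\<lambda>n y. indicator (G n) y * s n y"])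
    fix y
    obtain i where i: "0 < c i y" using c_pos by blast
    obtain k where k: "y \<in> G k" using G(4) by blast
    obtain N :: nat where N: "1 / c i y < real N" using reals_Archimedean2 by blast
    have "indicator (G n) y * s n y = 1" if n: "n \<ge> max k (max (Suc i) N)" for n
    proof -
      have "y \<in> G n" using k G(3) n by (auto dest: incseqD)
      moreover have "c i y \<le> (\<Sum>i<n. c i y)"
        using n by (intro member_le_sum) (auto simp: c)
      then have "real N * c i y \<le> real n * (\<Sum>i<n. c i y)"
        using n c(2)[of i y] by (intro mult_mono) auto
      moreover have "1 < real N * c i y" using N i by (simp add: field_simps)
      ultimately show ?thesis by (simp add: s_def)
    qed
    then have "\<forall>\<^sub>F n in sequentially. indicator (G n) y * s n y = 1"
      unfolding eventually_sequentially by blast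
    then show "(\<lambda>n. indicator (G n) y * s n y) \<longlonglongrightarrow> 1"
      by (rule tendsto_eventually)
  next
    show "(\<lambda>y. indicator (G n) y * s n y) \<in> cpt_supp_functions UNIV" for n
      by (intro cpt_supp_function_indicator_mult s G closed_open_subgroup)
  qed (use s01 in \<open>auto simp: indicator_def split: if_splits\<close>)
qed

section \<open>The dominant coset of a measure\<close>

text \<open>
  The group with its exhaustion, together with cutoff functions as in \<open>exhausting_cutoffs\<close>.
\<close>
locale exhausted_group =
  fixes G :: "nat \<Rightarrow> 'a::{topological_group_add, second_countable_topology, t2_space} set"
    and \<phi> :: "nat \<Rightarrow> 'a \<Rightarrow> real"
  assumes lc: "locally_compact_space (euclidean :: 'a topology)"
    and subgroup: "\<And>n. subgroup_add (G n)"
    and open_subgroup: "\<And>n. open (G n)"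
    and incseq_G: "incseq G"
    and UN_G: "(\<Union>n. G n) = UNIV"
    and cutoff: "\<And>n. \<phi> n \<in> cpt_supp_functions UNIV"
    and cutoff_nonneg: "\<And>n x. 0 \<le> \<phi> n x"
    and cutoff_le_1: "\<And>n x. \<phi> n x \<le> 1"
    and cutoff_support: "\<And>n x. \<phi> n x \<noteq> 0 \<Longrightarrow> x \<in> G n"
    and cutoff_tendsto: "\<And>x. (\<lambda>n. \<phi> n x) \<longlonglongrightarrow> 1"
begin

definition cutoff_mass :: "nat \<Rightarrow> 'a \<Rightarrow> 'a measure \<Rightarrow> real" where
  "cutoff_mass n g \<mu> = (\<integral>y. \<phi> n (- g + y) \<partial>\<mu>)"

text \<open>
  By how much the part of \<open>\<mu>\<close> seen by some translate of the \<open>n\<close>-th cutoff exceeds one half, where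
  only translates centred outside the coset \<open>x + G n\<close> compete. Since two disjoint cosets cannot both
  carry more than half of the mass, \<open>rival n x \<mu>\<close> is positive exactly if some translate of the
  cutoff sees more than half of the mass and \<open>x\<close> lies outside the one coset of \<open>G n\<close> in which this
  happens. Inserting \<open>0\<close> takes care of the empty set of competitors and of negative excess.
\<close>
definition rival :: "nat \<Rightarrow> 'a \<Rightarrow> 'a measure \<Rightarrow> real" where
  "rival n x \<mu> = Sup (insert 0 ((\<lambda>g. cutoff_mass n g \<mu> - 1/2) ` {g. - x + g \<notin> G n}))"

text \<open>
  The factor \<open>Suc n\<close> drives the penalty above \<open>1\<close> outside the dominant coset of \<open>G n\<close> for some
  finite \<open>n\<close>: the excess of a dominant cutoff stays bounded away from \<open>0\<close>, while the factor grows.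
\<close>
definition penalty :: "'a \<Rightarrow> 'a measure \<Rightarrow> real" where
  "penalty x \<mu> = (\<Sum>n. real (Suc n) * rival n x \<mu>)"

definition weight :: "real \<Rightarrow> 'a measure \<Rightarrow> 'a \<Rightarrow> real" where
  "weight t \<mu> x = t + (1 - t) * max 0 (1 - penalty x \<mu>)"

definition damp :: "real \<Rightarrow> 'a measure \<Rightarrow> 'a measure" where
  "damp t \<mu> = density \<mu> (\<lambda>x. ennreal (weight t \<mu> x))"

lemmas closed_subgroup = closed_open_subgroup[OF subgroup open_subgroup]

lemma G_mono: "m \<le> n \<Longrightarrow> x \<in> G m \<Longrightarrow> x \<in> G n"
  using incseq_G by (auto dest: incseqD)

lemma cutoff_translate: "(\<lambda>y. \<phi> n (- g + y)) \<in> cpt_supp_functions UNIV"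
  by (rule cpt_supp_function_translate[OF cutoff])

lemma cutoff_mass_le_1: "\<mu> \<in> cpt_measures UNIV \<Longrightarrow> cutoff_mass n g \<mu> \<le> 1"
  unfolding cutoff_mass_def
  by (intro integral_bounded_cpt_measure integrable_cpt_supp_function cutoff_translate cutoff_le_1) auto

lemma cutoff_mass_tendsto:
  assumes \<mu>: "\<mu> \<in> cpt_measures UNIV"
  shows "(\<lambda>n. cutoff_mass n 0 \<mu>) \<longlonglongrightarrow> measure \<mu> UNIV"
proof -
  interpret finite_measure \<mu> using \<mu> by (rule finite_measure_cpt_measure)
  have "(\<lambda>n. \<integral>y. \<phi> n y \<partial>\<mu>) \<longlonglongrightarrow> (\<integral>y. 1 \<partial>\<mu>)"
    by (rule integral_dominated_convergence[where w = "\<lambda>_. 1"])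
      (use cutoff_tendsto cutoff_nonneg cutoff_le_1
        borel_measurable_cpt_measure[OF \<mu> borel_measurable_cpt_supp_function[OF cutoff]] in auto)
  then show ?thesis by (simp add: cutoff_mass_def space_cpt_measure[OF \<mu>])
qed

text \<open>
  The mass seen by the cutoffs tends to the total mass, which is strictly above one half, whereas
  the threshold \<open>1/2 + 1/(n + 1)\<close> decreases to one half.
\<close>
lemma cutoff_mass_exceeds:
  assumes \<mu>: "\<mu> \<in> cpt_measures UNIV"
  obtains n where "1/2 + inverse (real (Suc n)) < cutoff_mass n 0 \<mu>"
proof -
  have "(\<lambda>n. cutoff_mass n 0 \<mu> - inverse (real (Suc n))) \<longlonglongrightarrow> measure \<mu> UNIV - 0"
    by (intro tendsto_diff cutoff_mass_tendsto \<mu> LIMSEQ_inverse_real_of_nat)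
  then have "\<forall>\<^sub>F n in sequentially. 1/2 < cutoff_mass n 0 \<mu> - inverse (real (Suc n))"
    using measure_cpt_measure_gt[OF \<mu>] by (intro order_tendstoD(1)) auto
  then obtain n where "1/2 < cutoff_mass n 0 \<mu> - inverse (real (Suc n))"
    by (meson eventually_happens trivial_limit_sequentially)
  then show ?thesis by (intro that[of n]) simp
qed

lemma cutoff_mass_exceeds_half:
  assumes "\<mu> \<in> cpt_measures UNIV"
  obtains n where "1/2 < cutoff_mass n 0 \<mu>"
proof -
  obtain n where "1/2 + inverse (real (Suc n)) < cutoff_mass n 0 \<mu>" using cutoff_mass_exceeds[OF assms] .
  moreover have "0 < inverse (real (Suc n))" by simp
  ultimately show ?thesis by (intro that[of n]) linarith
qed

lemma continuous_map_cutoff_mass: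
  "continuous_map (prod_topology euclidean (weak_star_topology UNIV)) euclideanreal
     (\<lambda>(g, \<mu>). cutoff_mass n g \<mu>)"
proof -
  have "continuous_map (euclidean :: 'a topology) euclidean uminus"
    by (simp add: continuous_on_minus)
  then have "continuous_map (prod_topology euclidean (weak_star_topology UNIV))
      (prod_topology euclidean (weak_star_topology UNIV)) (\<lambda>(g :: 'a, \<mu> :: 'a measure). (- g, \<mu>))"
    by (simp add: continuous_map_prod_top)
  from continuous_map_compose[OF this continuous_map_translate_integral[OF lc cutoff]]
  show ?thesis by (rule continuous_map_eq) (auto simp: cutoff_mass_def)
qed

lemma continuous_map_cutoff_mass_fixed:
  "continuous_map (weak_star_topology UNIV) euclideanreal (cutoff_mass n g)"
  unfolding cutoff_mass_def by (rule continuous_map_weak_star_integral[OF cutoff_translate])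

text \<open>
  Here the mass bounds enter: two test functions with values in \<open>[0, 1]\<close> and disjoint supports have
  integrals with sum at most the total mass, hence at most \<open>1\<close>.
\<close>
lemma cutoff_mass_supports_meet:
  assumes \<mu>: "\<mu> \<in> cpt_measures UNIV"
    and gt: "1/2 < cutoff_mass m g \<mu>" "1/2 < cutoff_mass n h \<mu>"
  obtains y where "\<phi> m (- g + y) \<noteq> 0" "\<phi> n (- h + y) \<noteq> 0"
proof (rule ccontr)
  assume "\<not> thesis"
  then have disj: "\<phi> m (- g + y) = 0 \<or> \<phi> n (- h + y) = 0" for y using that by blast
  have i: "integrable \<mu> (\<lambda>y. \<phi> k (- a + y))" for k a
    by (intro integrable_cpt_supp_function \<mu> cutoff_translate)
  have "cutoff_mass m g \<mu> + cutoff_mass n h \<mu> = (\<integral>y. \<phi> m (- g + y) + \<phi> n (- h + y) \<partial>\<mu>)"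
    by (simp add: cutoff_mass_def i)
  also have "\<dots> \<le> 1"
  proof (rule integral_bounded_cpt_measure[OF \<mu>])
    show "\<phi> m (- g + y) + \<phi> n (- h + y) \<le> 1" for y
      using disj[of y] cutoff_le_1[of m "- g + y"] cutoff_le_1[of n "- h + y"] by auto
  qed (auto intro: i)
  finally show False using gt by simp
qed

text \<open>
  The dominant coset of \<open>G n\<close> is unique, and it contains those of the earlier subgroups.
\<close>
lemma cutoff_mass_same_coset:
  assumes \<mu>: "\<mu> \<in> cpt_measures UNIV"
    and "m \<le> n" "1/2 < cutoff_mass m g \<mu>" "1/2 < cutoff_mass n h \<mu>"
  shows "- g + h \<in> G n"
proof -
  obtain y where "\<phi> m (- g + y) \<noteq> 0" "\<phi> n (- h + y) \<noteq> 0"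
    using cutoff_mass_supports_meet[OF \<mu> assms(3,4)] .
  then have "- g + y \<in> G n" "- h + y \<in> G n"
    using cutoff_support G_mono[OF \<open>m \<le> n\<close>] by blast+
  then have "(- g + y) + - (- h + y) \<in> G n"
    using subgroup[of n] by (blast intro: subgroup_add_add subgroup_add_minus)
  then show ?thesis by (simp add: minus_add add.assoc del: add_uminus_conv_diff)
qed

lemma bdd_above_rival:
  "\<mu> \<in> cpt_measures UNIV \<Longrightarrow>
    bdd_above (insert 0 ((\<lambda>g. cutoff_mass n g \<mu> - 1/2) ` {g. - x + g \<notin> G n}))"
  using cutoff_mass_le_1[of \<mu> n] by (intro bdd_aboveI[of _ "1/2"]) auto

lemma rival_nonneg: "\<mu> \<in> cpt_measures UNIV \<Longrightarrow> 0 \<le> rival n x \<mu>"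
  unfolding rival_def by (intro cSup_upper bdd_above_rival) auto

lemma cutoff_mass_le_rival:
  "\<mu> \<in> cpt_measures UNIV \<Longrightarrow> - x + g \<notin> G n \<Longrightarrow> cutoff_mass n g \<mu> - 1/2 \<le> rival n x \<mu>"
  unfolding rival_def by (intro cSup_upper bdd_above_rival) auto

lemma rival_le:
  assumes "0 \<le> c" and "\<And>g. - x + g \<notin> G n \<Longrightarrow> cutoff_mass n g \<mu> \<le> 1/2 + c"
  shows "rival n x \<mu> \<le> c"
  unfolding rival_def by (rule cSup_least) (use assms in \<open>auto simp: field_simps\<close>)

lemma rival_eq_0I:
  assumes "\<mu> \<in> cpt_measures UNIV" and "\<And>g. - x + g \<notin> G n \<Longrightarrow> cutoff_mass n g \<mu> \<le> 1/2"
  shows "rival n x \<mu> = 0"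
  using rival_le[of 0 x n \<mu>] rival_nonneg[OF assms(1), of n x] assms(2) by force

text \<open>
  A point of a dominant coset meets no rival, at that stage or at any later one.
\<close>
lemma rival_eq_0:
  assumes \<mu>: "\<mu> \<in> cpt_measures UNIV" and "m \<le> n" "1/2 < cutoff_mass m g \<mu>" and x: "- g + x \<in> G n"
  shows "rival n x \<mu> = 0"
proof (rule rival_eq_0I[OF \<mu>], rule ccontr)
  fix h assume h: "- x + h \<notin> G n" "\<not> cutoff_mass n h \<mu> \<le> 1/2"
  then have "- g + h \<in> G n" using cutoff_mass_same_coset[OF \<mu> assms(2,3), of h] by simp
  with x have "- (- g + x) + (- g + h) \<in> G n"
    using subgroup[of n] by (blast intro: subgroup_add_add subgroup_add_minus)
  with h(1) show False by (simp add: minus_add add.assoc del: add_uminus_conv_diff)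
qed

lemma rival_coset:
  assumes "h \<in> G n"
  shows "rival n (x + h) \<mu> = rival n x \<mu>"
proof -
  have "- (x + h) + g \<in> G n \<longleftrightarrow> - x + g \<in> G n" for g
  proof
    assume "- (x + h) + g \<in> G n"
    with assms have "h + (- (x + h) + g) \<in> G n" using subgroup[of n] by (blast intro: subgroup_add_add)
    then show "- x + g \<in> G n" by (simp add: minus_add add.assoc del: add_uminus_conv_diff)
  next
    assume "- x + g \<in> G n"
    with assms have "- h + (- x + g) \<in> G n"
      using subgroup[of n] by (blast intro: subgroup_add_add subgroup_add_minus)
    then show "- (x + h) + g \<in> G n" by (simp add: minus_add add.assoc del: add_uminus_conv_diff)
  qed
  then show ?thesis by (simp add: rival_def)
qed

lemma cutoff_mass_left_translate:
  assumes "\<mu> \<in> cpt_measures UNIV"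
  shows "cutoff_mass n (g + h) (left_translate g \<mu>) = cutoff_mass n h \<mu>"
proof -
  have "cutoff_mass n (g + h) (left_translate g \<mu>) = (\<integral>y. \<phi> n (- (g + h) + (g + y)) \<partial>\<mu>)"
    unfolding cutoff_mass_def using assms
    by (intro integral_left_translate borel_measurable_cpt_supp_function cutoff_translate)
  then show ?thesis by (simp add: cutoff_mass_def minus_add add.assoc del: add_uminus_conv_diff)
qed

lemma rival_left_translate:
  assumes "\<mu> \<in> cpt_measures UNIV"
  shows "rival n (g + x) (left_translate g \<mu>) = rival n x \<mu>"
proof -
  have "{h. - (g + x) + h \<notin> G n} = (+) g ` {h. - x + h \<notin> G n}"
  proof (intro subset_antisym subsetI)
    fix h assume "h \<in> {h. - (g + x) + h \<notin> G n}"
    then have "- g + h \<in> {h. - x + h \<notin> G n}" by (simp add: minus_add add.assoc del: add_uminus_conv_diff)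
    then have "g + (- g + h) \<in> (+) g ` {h. - x + h \<notin> G n}" by blast
    then show "h \<in> (+) g ` {h. - x + h \<notin> G n}" by (simp add: add.assoc[symmetric])
  qed (auto simp: minus_add add.assoc simp del: add_uminus_conv_diff)
  then show ?thesis
    unfolding rival_def by (simp add: image_image cutoff_mass_left_translate[OF assms])
qed

text \<open>
  A supremum of continuous functions is lower semicontinuous. For upper semicontinuity at \<open>\<mu>\<^sub>0\<close>, fix
  a cutoff \<open>\<phi> m\<close> that sees more than half of \<open>\<mu>\<^sub>0\<close>, hence of every nearby \<open>\<mu>\<close>. A competing translate
  by \<open>g\<close> that sees more than half of such a \<open>\<mu>\<close> must meet the support of \<open>\<phi> m\<close>, which confines \<open>g\<close>
  to a compact set \<open>L\<close>. So near \<open>\<mu>\<^sub>0\<close> only a supremum over a compact set matters, and the tube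
  lemma applies.
\<close>
lemma continuous_map_rival:
  "continuous_map (weak_star_topology UNIV) euclideanreal (rival n x)"
proof (rule continuous_map_realI)
  let ?W = "weak_star_topology UNIV :: 'a measure topology"
  fix \<mu>\<^sub>0 and e :: real assume "\<mu>\<^sub>0 \<in> topspace ?W" and e: "e > 0"
  then have \<mu>\<^sub>0: "\<mu>\<^sub>0 \<in> cpt_measures UNIV" by (simp add: topspace_weak_star_topology)
  define A where "A = {g. - x + g \<notin> G n}"
  have A: "closed A"
    using open_coset[OF open_subgroup, of x n] by (simp add: A_def closed_def Compl_eq)
  define c where "c = rival n x \<mu>\<^sub>0"
  have c0: "0 \<le> c" using rival_nonneg[OF \<mu>\<^sub>0] by (simp add: c_def)
  have "\<exists>U. openin ?W U \<and> \<mu>\<^sub>0 \<in> U \<and> (\<forall>\<mu>\<in>U. c - e < rival n x \<mu>)"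
  proof (cases "c < e")
    case True
    then have "\<forall>\<mu>\<in>topspace ?W. c - e < rival n x \<mu>"
      using rival_nonneg[of _ n x] by (fastforce simp: topspace_weak_star_topology)
    then show ?thesis
      using \<mu>\<^sub>0 topspace_weak_star_topology[of UNIV] by (metis openin_topspace)
  next
    case False
    have "c - e < Sup (insert 0 ((\<lambda>g. cutoff_mass n g \<mu>\<^sub>0 - 1/2) ` {g. - x + g \<notin> G n}))"
      using e by (simp add: c_def rival_def)
    then obtain r where "r \<in> insert 0 ((\<lambda>g. cutoff_mass n g \<mu>\<^sub>0 - 1/2) ` {g. - x + g \<notin> G n})" "c - e < r"
      using less_cSupD by (metis insert_not_empty)
    with False obtain g where g: "- x + g \<notin> G n" "c - e < cutoff_mass n g \<mu>\<^sub>0 - 1/2" by auto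
    let ?U = "{\<mu> \<in> topspace ?W. cutoff_mass n g \<mu> \<in> {c - e + 1/2<..}}"
    have "openin ?W ?U"
      by (rule openin_continuous_map_preimage[OF continuous_map_cutoff_mass_fixed]) simp
    moreover have "\<forall>\<mu>\<in>?U. c - e < rival n x \<mu>"
      using cutoff_mass_le_rival[OF _ g(1)] by (fastforce simp: topspace_weak_star_topology)
    ultimately show ?thesis
      using g(2) \<mu>\<^sub>0 by (intro exI[of _ ?U]) (auto simp: topspace_weak_star_topology)
  qed
  moreover have "\<exists>U. openin ?W U \<and> \<mu>\<^sub>0 \<in> U \<and> (\<forall>\<mu>\<in>U. rival n x \<mu> < c + e)"
  proof -
    obtain m where m: "1/2 < cutoff_mass m 0 \<mu>\<^sub>0" using cutoff_mass_exceeds_half[OF \<mu>\<^sub>0] .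
    obtain S where S: "compact S" "\<And>y. y \<notin> S \<Longrightarrow> \<phi> m y = 0"
      using cutoff[of m] by (auto simp: cpt_supp_functions_def)
    obtain T where T: "compact T" "\<And>y. y \<notin> T \<Longrightarrow> \<phi> n y = 0"
      using cutoff[of n] by (auto simp: cpt_supp_functions_def)
    define L where "L = (\<lambda>(y, s). y + - s) ` (S \<times> T)"
    have L: "compact L"
      unfolding L_def split_def
      by (intro compact_continuous_image compact_Times S T continuous_intros)
    have confined: "g \<in> L"
      if hyps: "\<mu> \<in> cpt_measures UNIV" "1/2 < cutoff_mass m 0 \<mu>" "1/2 < cutoff_mass n g \<mu>" for g \<mu>
    proof -
      obtain y where "\<phi> m (- 0 + y) \<noteq> 0" "\<phi> n (- g + y) \<noteq> 0"
        by (rule cutoff_mass_supports_meet[OF hyps])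
      then have "y \<in> S" "- g + y \<in> T" using S(2) T(2) by auto
      then have "y + - (- g + y) \<in> L" unfolding L_def by force
      then show ?thesis by (simp add: minus_add add.assoc[symmetric])
    qed
    \<comment> \<open>The margin \<open>e/2\<close> keeps the supremum over \<open>L \<inter> A\<close> strictly below \<open>c + e\<close>.\<close>
    define P where "P = {p \<in> topspace (prod_topology euclidean ?W).
        (case p of (g, \<mu>) \<Rightarrow> cutoff_mass n g \<mu>) \<in> {..<1/2 + c + e/2}}"
    have "openin (prod_topology euclidean ?W) P"
      unfolding P_def by (rule openin_continuous_map_preimage[OF continuous_map_cutoff_mass]) simp
    moreover have "compactin euclidean (L \<inter> A)" using L A by (simp add: compact_Int_closed)
    moreover have "(L \<inter> A) \<times> {\<mu>\<^sub>0} \<subseteq> P"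
      using cutoff_mass_le_rival[OF \<mu>\<^sub>0, of x _ n] e \<mu>\<^sub>0
      by (fastforce simp: P_def A_def c_def topspace_weak_star_topology)
    ultimately obtain U V where V: "openin ?W V" "\<mu>\<^sub>0 \<in> V" "L \<inter> A \<subseteq> U" "U \<times> V \<subseteq> P"
      using tube_lemma_left[of euclidean ?W P "L \<inter> A" \<mu>\<^sub>0] \<mu>\<^sub>0
      by (auto simp: topspace_weak_star_topology)
    let ?V = "V \<inter> {\<mu> \<in> topspace ?W. cutoff_mass m 0 \<mu> \<in> {1/2<..}}"
    have "openin ?W {\<mu> \<in> topspace ?W. cutoff_mass m 0 \<mu> \<in> {1/2<..}}"
      by (rule openin_continuous_map_preimage[OF continuous_map_cutoff_mass_fixed]) simp
    then have "openin ?W ?V" using V(1) by blast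
    moreover have "rival n x \<mu> < c + e" if "\<mu> \<in> ?V" for \<mu>
    proof -
      have \<mu>: "\<mu> \<in> cpt_measures UNIV" "1/2 < cutoff_mass m 0 \<mu>" and "\<mu> \<in> V"
        using that by (auto simp: topspace_weak_star_topology)
      have "rival n x \<mu> \<le> c + e/2"
      proof (rule rival_le)
        fix g assume "- x + g \<notin> G n"
        then have "g \<in> A" by (simp add: A_def)
        show "cutoff_mass n g \<mu> \<le> 1/2 + (c + e/2)"
        proof (cases "1/2 < cutoff_mass n g \<mu>")
          case True
          with confined \<mu> \<open>g \<in> A\<close> have "g \<in> L \<inter> A" by blast
          with V(3,4) \<open>\<mu> \<in> V\<close> have "(g, \<mu>) \<in> P" by blast
          then show ?thesis by (simp add: P_def)
        next
          case False
          then show ?thesis using c0 e by simp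
        qed
      qed (use c0 e in simp)
      with e show ?thesis by simp
    qed
    moreover have "\<mu>\<^sub>0 \<in> ?V" using V(2) m \<mu>\<^sub>0 by (simp add: topspace_weak_star_topology)
    ultimately show ?thesis by blast
  qed
  ultimately obtain U V where "openin ?W U" "\<mu>\<^sub>0 \<in> U" "\<forall>\<mu>\<in>U. c - e < rival n x \<mu>"
      "openin ?W V" "\<mu>\<^sub>0 \<in> V" "\<forall>\<mu>\<in>V. rival n x \<mu> < c + e"
    by blast
  then show "\<exists>U. openin ?W U \<and> \<mu>\<^sub>0 \<in> U \<and> (\<forall>\<mu>\<in>U. \<bar>rival n x \<mu> - rival n x \<mu>\<^sub>0\<bar> < e)"
    by (intro exI[of _ "U \<inter> V"]) (auto simp: c_def abs_less_iff)
qed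

text \<open>
  The bound \<open>N\<close> depends on \<open>\<mu>\<close> only through the open condition \<open>1/2 < cutoff_mass m 0 \<mu>\<close>, so the
  series defining the penalty is locally a finite sum.
\<close>
lemma penalty_eq_sum:
  assumes \<mu>: "\<mu> \<in> cpt_measures UNIV" "1/2 < cutoff_mass m 0 \<mu>" and N: "m \<le> N" "x \<in> G N"
  shows "penalty x \<mu> = (\<Sum>n<N. real (Suc n) * rival n x \<mu>)"
  unfolding penalty_def
proof (rule suminf_finite)
  fix n assume "n \<notin> {..<N}"
  then have "N \<le> n" by simp
  then show "real (Suc n) * rival n x \<mu> = 0"
    using rival_eq_0[OF \<mu>(1) _ \<mu>(2), of n x] N G_mono[of N n x] by simp
qed simp

lemma penalty_eq_sum_large:
  assumes \<mu>: "\<mu> \<in> cpt_measures UNIV"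
  obtains N where "N \<ge> k" "penalty x \<mu> = (\<Sum>n<N. real (Suc n) * rival n x \<mu>)"
proof -
  obtain m where m: "1/2 < cutoff_mass m 0 \<mu>" using cutoff_mass_exceeds_half[OF \<mu>] .
  obtain j where "x \<in> G j" using UN_G by blast
  then have "x \<in> G (max j (max m k))" by (rule G_mono[rotated]) simp
  with penalty_eq_sum[OF \<mu> m, of "max j (max m k)"] that[of "max j (max m k)"]
  show ?thesis by simp
qed

lemma penalty_nonneg: "\<mu> \<in> cpt_measures UNIV \<Longrightarrow> 0 \<le> penalty x \<mu>"
  by (rule penalty_eq_sum_large[of \<mu> 0 x]) (auto intro!: sum_nonneg simp: rival_nonneg)

lemma rival_le_penalty:
  assumes \<mu>: "\<mu> \<in> cpt_measures UNIV"
  shows "real (Suc k) * rival k x \<mu> \<le> penalty x \<mu>"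
proof -
  obtain N where N: "N \<ge> Suc k" "penalty x \<mu> = (\<Sum>n<N. real (Suc n) * rival n x \<mu>)"
    using penalty_eq_sum_large[OF \<mu>] .
  show ?thesis
    unfolding N(2) using N(1)
    by (intro member_le_sum[of k "{..<N}" "\<lambda>n. real (Suc n) * rival n x \<mu>"])
      (auto simp: rival_nonneg[OF \<mu>])
qed

lemma penalty_coset:
  assumes "h \<in> G 0"
  shows "penalty (x + h) \<mu> = penalty x \<mu>"
proof -
  have "rival n (x + h) \<mu> = rival n x \<mu>" for n
    using assms by (intro rival_coset G_mono[of 0 n]) auto
  then show ?thesis by (simp add: penalty_def)
qed

lemma penalty_left_translate:
  "\<mu> \<in> cpt_measures UNIV \<Longrightarrow> penalty (g + x) (left_translate g \<mu>) = penalty x \<mu>"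
  by (simp add: penalty_def rival_left_translate)

lemma openin_cutoff_mass_greater:
  "openin (weak_star_topology UNIV) {\<mu> \<in> cpt_measures UNIV. c < cutoff_mass m g \<mu>}"
  using openin_continuous_map_preimage[OF continuous_map_cutoff_mass_fixed, of "{c<..}" m g]
  by (simp add: topspace_weak_star_topology)

lemma continuous_map_penalty:
  "continuous_map (weak_star_topology UNIV) euclideanreal (penalty x)"
proof (rule continuous_map_locally)
  let ?W = "weak_star_topology UNIV :: 'a measure topology"
  fix \<mu>\<^sub>0 assume "\<mu>\<^sub>0 \<in> topspace ?W"
  then have \<mu>\<^sub>0: "\<mu>\<^sub>0 \<in> cpt_measures UNIV" by (simp add: topspace_weak_star_topology)
  obtain m where m: "1/2 < cutoff_mass m 0 \<mu>\<^sub>0" using cutoff_mass_exceeds_half[OF \<mu>\<^sub>0] .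
  obtain j where "x \<in> G j" using UN_G by blast
  then have N: "x \<in> G (max m j)" by (rule G_mono[rotated]) simp
  \<comment> \<open>On \<open>?U\<close> the terms with \<open>n \<ge> max m j\<close> vanish: the dominant coset is \<open>G n\<close> itself, and \<open>x \<in> G n\<close>.\<close>
  let ?U = "{\<mu> \<in> cpt_measures UNIV. 1/2 < cutoff_mass m 0 \<mu>}"
  have "continuous_map (subtopology ?W ?U) euclideanreal
      (\<lambda>\<mu>. \<Sum>n<max m j. real (Suc n) * rival n x \<mu>)"
    by (intro continuous_map_from_subtopology continuous_map_sum continuous_map_real_mult
        continuous_map_rival) simp_all
  then have "continuous_map (subtopology ?W ?U) euclideanreal (penalty x)"
    by (rule continuous_map_eq) (use penalty_eq_sum[OF _ _ _ N] in auto)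
  then show "\<exists>U. openin ?W U \<and> \<mu>\<^sub>0 \<in> U \<and> continuous_map (subtopology ?W U) euclideanreal (penalty x)"
    using openin_cutoff_mass_greater[of "1/2" m 0] m \<mu>\<^sub>0 by blast
qed
section \<open>Damping a measure towards its dominant coset\<close>

lemma weight_bounds:
  assumes "\<mu> \<in> cpt_measures UNIV" "t \<in> {0..1}"
  shows "0 \<le> weight t \<mu> x" "weight t \<mu> x \<le> 1"
proof -
  let ?r = "max 0 (1 - penalty x \<mu>)"
  have r: "0 \<le> ?r" "?r \<le> 1" using penalty_nonneg[OF assms(1), of x] by auto
  show "0 \<le> weight t \<mu> x" using r assms(2) by (simp add: weight_def)
  have "(1 - t) * ?r \<le> (1 - t) * 1" using r assms(2) by (intro mult_left_mono) auto
  then show "weight t \<mu> x \<le> 1" by (simp add: weight_def)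
qed

lemma weight_coset: "h \<in> G 0 \<Longrightarrow> weight t \<mu> (x + h) = weight t \<mu> x"
  by (simp add: weight_def penalty_coset)

lemma borel_measurable_weight: "weight t \<mu> \<in> borel_measurable borel"
  by (rule borel_measurable_coset_invariant[OF subgroup open_subgroup]) (rule weight_coset)

text \<open>
  This keeps the damped mass above one half. Take the least stage \<open>n\<close> at which a translated cutoff
  sees more than half of the mass. Points at which that translate is nonzero have no rival: none
  at earlier stages, where no translate sees that much, and none from \<open>n\<close> on, where they lie in
  the dominant coset. So they keep full weight.
\<close>
lemma cutoff_le_weight:
  assumes \<mu>: "\<mu> \<in> cpt_measures UNIV" and t: "t \<in> {0..1}"
  obtains n g where "1/2 < cutoff_mass n g \<mu>" "\<And>y. \<phi> n (- g + y) \<le> weight t \<mu> y"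
proof -
  define n where "n = (LEAST n. \<exists>g. 1/2 < cutoff_mass n g \<mu>)"
  obtain m where "1/2 < cutoff_mass m 0 \<mu>" using cutoff_mass_exceeds_half[OF \<mu>] .
  then have "\<exists>m g. 1/2 < cutoff_mass m g \<mu>" by blast
  then have "\<exists>g. 1/2 < cutoff_mass n g \<mu>" unfolding n_def by (rule LeastI_ex)
  then obtain g where g: "1/2 < cutoff_mass n g \<mu>" by blast
  have before: "cutoff_mass k h \<mu> \<le> 1/2" if "k < n" for k h
    using not_less_Least[of k "\<lambda>n. \<exists>g. 1/2 < cutoff_mass n g \<mu>"] that unfolding n_def[symmetric] by (metis not_le)
  have "\<phi> n (- g + y) \<le> weight t \<mu> y" for y
  proof (cases "\<phi> n (- g + y) = 0")
    case True
    then show ?thesis using weight_bounds(1)[OF \<mu> t] by simp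
  next
    case False
    then have y: "- g + y \<in> G n" by (rule cutoff_support)
    have "rival k y \<mu> = 0" for k
    proof (cases "k < n")
      case True
      then show ?thesis using before by (intro rival_eq_0I[OF \<mu>]) auto
    next
      case False
      then show ?thesis using rival_eq_0[OF \<mu> _ g, of k y] G_mono[OF _ y] by simp
    qed
    then have "weight t \<mu> y = 1" by (simp add: weight_def penalty_def)
    then show ?thesis using cutoff_le_1 by simp
  qed
  with g that show ?thesis by blast
qed

lemma emeasure_damp:
  assumes \<mu>: "\<mu> \<in> cpt_measures UNIV" and "A \<in> sets borel"
  shows "emeasure (damp t \<mu>) A = (\<integral>\<^sup>+x. ennreal (weight t \<mu> x) * indicator A x \<partial>\<mu>)"
  unfolding damp_def using assms borel_measurable_cpt_measure[OF \<mu> borel_measurable_weight]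
  by (intro emeasure_density) (auto simp: sets_cpt_measure)

lemma emeasure_damp_null:
  assumes \<mu>: "\<mu> \<in> cpt_measures UNIV" and "A \<in> sets borel" "emeasure \<mu> A = 0"
  shows "emeasure (damp t \<mu>) A = 0"
proof -
  have "A \<in> null_sets \<mu>" using assms by (intro null_setsI) (simp_all add: sets_cpt_measure)
  then show ?thesis unfolding emeasure_damp[OF assms(1,2)] by (rule nn_integral_null_set)
qed

lemma sets_damp: "\<mu> \<in> cpt_measures UNIV \<Longrightarrow> sets (damp t \<mu>) = sets borel"
  by (simp add: damp_def sets_cpt_measure)

lemma damp_cpt_measure:
  assumes \<mu>: "\<mu> \<in> cpt_measures UNIV" and t: "t \<in> {0..1}"
  shows "damp t \<mu> \<in> cpt_measures UNIV"
proof -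
  obtain K where K: "compact K" "emeasure \<mu> (- K) = 0"
    using \<mu> by (auto simp: cpt_measures_UNIV_iff)
  then have "emeasure (damp t \<mu>) (- K) = 0"
    by (intro emeasure_damp_null[OF \<mu>]) (auto dest: compact_imp_closed)
  moreover have i: "integrable \<mu> (weight t \<mu>)"
    using weight_bounds[OF \<mu> t]
    by (intro integrable_bounded_cpt_measure[OF \<mu> borel_measurable_weight, where B = 1]) auto
  have "emeasure (damp t \<mu>) UNIV = ennreal (\<integral>x. weight t \<mu> x \<partial>\<mu>)"
    using emeasure_damp[OF \<mu>, of UNIV t] nn_integral_eq_integral[OF i] weight_bounds(1)[OF \<mu> t]
    by simp
  moreover have "(\<integral>x. weight t \<mu> x \<partial>\<mu>) \<le> 1"
    by (intro integral_bounded_cpt_measure[OF \<mu> i] weight_bounds \<mu> t) simp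
  moreover have half: "1/2 < (\<integral>x. weight t \<mu> x \<partial>\<mu>)"
  proof -
    obtain n g where ng: "1/2 < cutoff_mass n g \<mu>" "\<And>y. \<phi> n (- g + y) \<le> weight t \<mu> y"
      using cutoff_le_weight[OF \<mu> t] by blast
    have "cutoff_mass n g \<mu> \<le> (\<integral>x. weight t \<mu> x \<partial>\<mu>)"
      unfolding cutoff_mass_def
      by (intro integral_mono i integrable_cpt_supp_function \<mu> cutoff_translate ng(2))
    with ng(1) show ?thesis by simp
  qed
  moreover from half have "ennreal (1/2) < ennreal (\<integral>x. weight t \<mu> x \<partial>\<mu>)"
    by (intro ennreal_lessI) auto
  ultimately show ?thesis
    using K(1) sets_damp[OF \<mu>] unfolding cpt_measures_UNIV_iff ennreal_half by auto
qed

lemma damp_1: "damp 1 \<mu> = \<mu>"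
  by (simp add: damp_def weight_def density_1)

lemma damp_left_translate:
  assumes \<mu>: "\<mu> \<in> cpt_measures UNIV"
  shows "damp t (left_translate g \<mu>) = left_translate g (damp t \<mu>)"
proof -
  have "weight t (left_translate g \<mu>) (g + x) = weight t \<mu> x" for x
    by (simp add: weight_def penalty_left_translate[OF \<mu>])
  moreover have "density (distr \<mu> borel ((+) g)) (\<lambda>x. ennreal (weight t (left_translate g \<mu>) x))
      = distr (density \<mu> (\<lambda>x. ennreal (weight t (left_translate g \<mu>) (g + x)))) borel ((+) g)"
    using borel_measurable_weight measurable_translation_cpt_measure[OF \<mu>]
    by (intro density_distr) auto
  ultimately show ?thesis by (simp add: damp_def left_translate_def)
qed

lemma continuous_map_damp:
  "continuous_map (prod_topology (top_of_set {0..1}) (weak_star_topology UNIV))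
     (weak_star_topology UNIV) (\<lambda>(t, \<mu>). damp t \<mu>)"
proof (rule continuous_map_into_weak_star)
  let ?Z = "prod_topology (top_of_set {0..1::real}) (weak_star_topology UNIV :: 'a measure topology)"
  have mem: "fst z \<in> {0..1}" "snd z \<in> cpt_measures UNIV" if "z \<in> topspace ?Z" for z
    using that by (auto simp: topspace_weak_star_topology)
  show "(case z of (t, \<mu>) \<Rightarrow> damp t \<mu>) \<in> cpt_measures UNIV" if "z \<in> topspace ?Z" for z
    using damp_cpt_measure mem[OF that] by (simp add: split_def)
  fix f :: "'a \<Rightarrow> real" assume f: "f \<in> cpt_supp_functions UNIV"
  have "continuous_map ?Z euclideanreal (\<lambda>z. \<integral>y. weight (fst z) (snd z) y * f y \<partial>snd z)"
  proof (rule continuous_map_coset_weighted_integral[OF subgroup open_subgroup _ _ _ f])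
    show "continuous_map ?Z (weak_star_topology UNIV) snd" by (rule continuous_map_snd)
    show "weight (fst z) (snd z) (x + h) = weight (fst z) (snd z) x" if "h \<in> G 0" for z x h
      using that by (rule weight_coset)
    fix x
    have t: "continuous_map ?Z euclideanreal fst"
      using continuous_map_fst by (auto dest: continuous_map_into_fulltopology)
    have p: "continuous_map ?Z euclideanreal (\<lambda>z. penalty x (snd z))"
      using continuous_map_compose[OF continuous_map_snd continuous_map_penalty]
      by (simp add: o_def)
    show "continuous_map ?Z euclideanreal (\<lambda>z. weight (fst z) (snd z) x)"
      unfolding weight_def
      by (intro continuous_map_add continuous_map_real_mult continuous_map_diff
          continuous_map_real_max t p continuous_map_const[THEN iffD2]) auto
  qed
  moreover have "(\<integral>y. weight (fst z) (snd z) y * f y \<partial>snd z) = (\<integral>y. f y \<partial>(case z of (t, \<mu>) \<Rightarrow> damp t \<mu>))"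
    if "z \<in> topspace ?Z" for z
    unfolding damp_def split_def
    using weight_bounds(1)[OF mem(2)[OF that] mem(1)[OF that]]
      borel_measurable_cpt_measure[OF mem(2)[OF that] borel_measurable_weight]
      borel_measurable_cpt_measure[OF mem(2)[OF that] borel_measurable_cpt_supp_function[OF f]]
    by (subst integral_density) auto
  ultimately show "continuous_map ?Z euclideanreal (\<lambda>z. \<integral>y. f y \<partial>(case z of (t, \<mu>) \<Rightarrow> damp t \<mu>))"
    by (rule continuous_map_eq)
qed
section \<open>The direct limit topology on measures\<close>

text \<open>
  The image of the measures on \<open>G n\<close> under extension by zero.
\<close>
definition stage :: "nat \<Rightarrow> 'a measure set" where
  "stage n = {\<mu> \<in> cpt_measures UNIV. \<exists>K. compact K \<and> K \<subseteq> G n \<and> emeasure \<mu> (- K) = 0}"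

lemma stage_cpt_measure: "\<mu> \<in> stage n \<Longrightarrow> \<mu> \<in> cpt_measures UNIV"
  by (simp add: stage_def)

lemma stage_mono: "m \<le> n \<Longrightarrow> stage m \<subseteq> stage n"
  using G_mono[of m n] unfolding stage_def by blast

lemma damp_stage:
  assumes \<mu>: "\<mu> \<in> stage n" and "t \<in> {0..1}"
  shows "damp t \<mu> \<in> stage n"
proof -
  obtain K where K: "compact K" "K \<subseteq> G n" "emeasure \<mu> (- K) = 0"
    using \<mu> by (auto simp: stage_def)
  then have "emeasure (damp t \<mu>) (- K) = 0"
    by (intro emeasure_damp_null stage_cpt_measure[OF \<mu>]) (auto dest: compact_imp_closed)
  with K damp_cpt_measure[OF stage_cpt_measure[OF \<mu>] assms(2)] show ?thesis
    unfolding stage_def by blast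
qed

lemma left_translate_stage:
  assumes \<mu>: "\<mu> \<in> stage n" and "g \<in> G n"
  shows "left_translate g \<mu> \<in> stage n"
proof -
  obtain K where K: "compact K" "K \<subseteq> G n" "emeasure \<mu> (- K) = 0"
    using \<mu> by (auto simp: stage_def)
  have "(+) g ` K \<subseteq> G n" using K(2) assms(2) subgroup_add_add[OF subgroup] by blast
  with left_translate_support[OF stage_cpt_measure[OF \<mu>] K(1,3)]
    cpt_measure_left_translate[OF stage_cpt_measure[OF \<mu>]]
  show ?thesis unfolding stage_def by blast
qed

text \<open>
  Outside \<open>G m\<close> the centred cutoff is itself a rival, with excess above \<open>1/(m + 1)\<close>; the penalty there
  is above \<open>1\<close> and the mass is deleted. The hypothesis on \<open>\<mu>\<close> is an open condition, so \<open>damp 0\<close>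
  locally takes values in a single stage.
\<close>
lemma damp_0_in_stage:
  assumes \<mu>: "\<mu> \<in> cpt_measures UNIV" and gt: "1/2 + inverse (real (Suc m)) < cutoff_mass m 0 \<mu>"
  shows "damp 0 \<mu> \<in> stage m"
proof -
  obtain K where K: "compact K" "emeasure \<mu> (- K) = 0"
    using \<mu> by (auto simp: cpt_measures_UNIV_iff)
  have "weight 0 \<mu> x = 0" if "x \<notin> G m" for x
  proof -
    have "- x + 0 \<notin> G m" using that subgroup_add_minus[OF subgroup, of "- x" m] by auto
    then have "inverse (real (Suc m)) < rival m x \<mu>"
      using cutoff_mass_le_rival[OF \<mu>] gt by fastforce
    then have "1 < real (Suc m) * rival m x \<mu>" by (simp add: field_simps)
    then have "1 < penalty x \<mu>" using rival_le_penalty[OF \<mu>, of m x] by linarith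
    then show ?thesis by (simp add: weight_def)
  qed
  then have "ennreal (weight 0 \<mu> x) * indicator (- G m) x = 0" for x
    by (cases "x \<in> G m") auto
  then have out: "emeasure (damp 0 \<mu>) (- G m) = 0"
    using open_subgroup by (simp add: emeasure_damp[OF \<mu>] del: mult_eq_0_iff)
  have "emeasure (damp 0 \<mu>) (- K) = 0"
    using K by (intro emeasure_damp_null \<mu>) (auto dest: compact_imp_closed)
  with out have "emeasure (damp 0 \<mu>) (- G m \<union> - K) \<le> 0"
    using emeasure_subadditive[of "- G m" "damp 0 \<mu>" "- K"] K(1) open_subgroup
    by (simp add: sets_damp[OF \<mu>] compact_imp_closed)
  then have "emeasure (damp 0 \<mu>) (- (G m \<inter> K)) = 0" by (simp add: Compl_Int)
  moreover have "compact (G m \<inter> K)" using K(1) closed_subgroup by (metis closed_Int_compact)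
  ultimately show ?thesis
    using damp_cpt_measure[OF \<mu>, of 0] unfolding stage_def by auto
qed

definition stage_topology :: "nat \<Rightarrow> 'a measure topology" where
  "stage_topology n = subtopology (weak_star_topology UNIV) (stage n)"

lemma measures_lim_topology_eq: "measures_lim_topology G = direct_limit_topology stage_topology"
  unfolding measures_lim_topology_def stage_topology_def
  by (simp add: extend_by_zero_image[OF open_subgroup] stage_def)

lemma topspace_stage_topology: "topspace (stage_topology n) = stage n"
  by (auto simp: stage_topology_def topspace_weak_star_topology stage_def)

lemma topspace_measures_lim:
  "topspace (measures_lim_topology G) \<subseteq> cpt_measures UNIV"
  using stage_cpt_measure
  by (auto simp: measures_lim_topology_eq topspace_direct_limit_topology topspace_stage_topology)

lemma continuous_map_into_measures_lim:
  assumes "continuous_map Z (weak_star_topology UNIV) f" and "\<And>z. z \<in> topspace Z \<Longrightarrow> f z \<in> stage n"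
  shows "continuous_map Z (measures_lim_topology G) f"
  unfolding measures_lim_topology_eq
  by (rule continuous_map_direct_limit_into[of _ _ n])
    (use assms in \<open>auto simp: stage_topology_def continuous_map_in_subtopology\<close>)

lemma continuous_map_prod_stage:
  assumes "continuous_map (prod_topology Z (weak_star_topology UNIV)) Y F"
  shows "continuous_map (prod_topology Z (stage_topology n)) Y F"
  unfolding stage_topology_def prod_topology_subtopology
  using assms by (rule continuous_map_from_subtopology)

lemma continuous_map_measures_lim_weak_star:
  "continuous_map (measures_lim_topology G) (weak_star_topology UNIV) id"
  unfolding measures_lim_topology_eq
  by (rule continuous_map_direct_limit_from)
    (auto simp: stage_topology_def intro: continuous_map_from_subtopology)

text \<open>
  Locally the values lie in one stage, and a weak* continuous map into one stage is continuous
  into the limit.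
\<close>
lemma continuous_map_damp_0:
  "continuous_map (weak_star_topology UNIV) (measures_lim_topology G) (damp 0)"
proof (rule continuous_map_locally)
  let ?W = "weak_star_topology UNIV :: 'a measure topology"
  fix \<mu>\<^sub>0 assume "\<mu>\<^sub>0 \<in> topspace ?W"
  then have \<mu>\<^sub>0: "\<mu>\<^sub>0 \<in> cpt_measures UNIV" by (simp add: topspace_weak_star_topology)
  obtain m where m: "1/2 + inverse (real (Suc m)) < cutoff_mass m 0 \<mu>\<^sub>0" using cutoff_mass_exceeds[OF \<mu>\<^sub>0] .
  let ?U = "{\<mu> \<in> cpt_measures UNIV. 1/2 + inverse (real (Suc m)) < cutoff_mass m 0 \<mu>}"
  have "continuous_map ?W (prod_topology (top_of_set {0..1::real}) ?W) (\<lambda>\<mu>. (0, \<mu>))"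
    by (intro continuous_map_pairedI) auto
  from continuous_map_compose[OF this continuous_map_damp]
  have "continuous_map ?W ?W (damp 0)" by (simp add: o_def)
  then have "continuous_map (subtopology ?W ?U) (measures_lim_topology G) (damp 0)"
    by (intro continuous_map_into_measures_lim[of _ _ m] continuous_map_from_subtopology)
      (auto intro: damp_0_in_stage)
  then show "\<exists>U. openin ?W U \<and> \<mu>\<^sub>0 \<in> U \<and>
      continuous_map (subtopology ?W U) (measures_lim_topology G) (damp 0)"
    using openin_cutoff_mass_greater m \<mu>\<^sub>0 by (intro exI[of _ ?U]) auto
qed

lemma continuous_map_damp_lim:
  "continuous_map (prod_topology (top_of_set {0..1}) (measures_lim_topology G))
     (measures_lim_topology G) (\<lambda>(t, \<mu>). damp t \<mu>)"
proof (subst (1) measures_lim_topology_eq, rule continuous_map_prod_direct_limit_from)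
  show "locally_compact_space (top_of_set {0..1::real})"
    by (intro compact_imp_locally_compact_space) (simp add: compact_space_subtopology)
  show "Hausdorff_space (top_of_set {0..1::real})"
    by (intro Hausdorff_space_subtopology) simp
  show "continuous_map (prod_topology (top_of_set {0..1}) (stage_topology n))
      (measures_lim_topology G) (\<lambda>(t, \<mu>). damp t \<mu>)" for n
    by (rule continuous_map_into_measures_lim[of _ _ n, OF continuous_map_prod_stage[OF continuous_map_damp]])
      (auto simp: topspace_stage_topology intro: damp_stage)
qed

text \<open>
  A given \<open>g\<close> lies in some \<open>G m\<close> with \<open>m \<ge> n\<close>, and all elements of the open set \<open>G m\<close> translate
  stage \<open>n\<close> into stage \<open>m\<close>. So the action is continuous on each stage with values in the limit.
\<close>
lemma G_space_measures_lim: "G_space (measures_lim_topology G) left_translate"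
  unfolding G_space_def
proof (intro conjI ballI allI)
  let ?W = "weak_star_topology UNIV :: 'a measure topology"
  have act: "continuous_map (prod_topology euclidean ?W) ?W (\<lambda>(g, x). left_translate g x)"
    using G_space_weak_star[OF lc] by (simp add: G_space_def)
  show "continuous_map (prod_topology euclidean (measures_lim_topology G))
      (measures_lim_topology G) (\<lambda>(g, x). left_translate g x)"
  proof (subst (1) measures_lim_topology_eq, rule continuous_map_prod_direct_limit_from)
    show "continuous_map (prod_topology euclidean (stage_topology n))
        (measures_lim_topology G) (\<lambda>(g, x). left_translate g x)" for n
    proof (rule continuous_map_locally, clarify)
      let ?Z = "prod_topology (euclidean :: 'a topology) (stage_topology n)"
      fix g \<mu> assume g\<mu>: "(g, \<mu>) \<in> topspace ?Z"
      obtain k where "g \<in> G k" using UN_G by blast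
      then have g: "g \<in> G (max k n)" by (rule G_mono[rotated]) simp
      let ?U = "G (max k n) \<times> topspace (stage_topology n)"
      have "openin ?Z ?U" by (simp add: openin_prod_Times_iff open_subgroup)
      moreover have "left_translate h \<nu> \<in> stage (max k n)"
        if "h \<in> G (max k n)" "\<nu> \<in> stage n" for h \<nu>
        using that stage_mono[of n "max k n"] by (intro left_translate_stage) auto
      then have "continuous_map (subtopology ?Z ?U) (measures_lim_topology G) (\<lambda>(g, x). left_translate g x)"
        by (intro continuous_map_into_measures_lim[of _ _ "max k n"] continuous_map_from_subtopology
            continuous_map_prod_stage act) (auto simp: topspace_stage_topology)
      ultimately show "\<exists>U. openin ?Z U \<and> (g, \<mu>) \<in> U \<and> continuous_map (subtopology ?Z U)
          (measures_lim_topology G) (\<lambda>(g, x). left_translate g x)"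
        using g g\<mu> by (intro exI[of _ ?U]) auto
    qed
  qed (simp_all add: lc Hausdorff_space_t2)
qed (use topspace_measures_lim in \<open>auto simp: left_translate_zero left_translate_add\<close>)

text \<open>
  Stated for both topologies at once: the same formula is the homotopy on either side.
\<close>
lemma homotopic_with_damp:
  assumes X: "topspace X \<subseteq> cpt_measures UNIV" "G_space X left_translate"
    and H: "continuous_map (prod_topology (top_of_set {0..1}) X) X (\<lambda>(t, \<mu>). damp t \<mu>)"
  shows "homotopic_with (equivariant X left_translate left_translate) X X (damp 0) id"
proof -
  have "continuous_map (prod_topology euclidean X) X (\<lambda>(g, \<mu>). left_translate g \<mu>)"
    using X(2) by (simp add: G_space_def)
  from continuous_map_funspace[OF this]
  have closed: "left_translate g \<mu> \<in> topspace X" if "\<mu> \<in> topspace X" for g \<mu>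
    using that funcset_mem[of _ _ _ "(g, \<mu>)"] by fastforce
  show ?thesis
  proof (subst homotopic_with)
    show "equivariant X left_translate left_translate h = equivariant X left_translate left_translate k"
      if "\<And>x. x \<in> topspace X \<Longrightarrow> h x = k x" for h k :: "'a measure \<Rightarrow> 'a measure"
      using that closed by (simp add: equivariant_def)
    show "\<exists>h. continuous_map (prod_topology (top_of_set {0..1::real}) X) X h \<and>
        (\<forall>x\<in>topspace X. h (0, x) = damp 0 x) \<and> (\<forall>x\<in>topspace X. h (1, x) = id x) \<and>
        (\<forall>t\<in>{0..1}. equivariant X left_translate left_translate (\<lambda>x. h (t, x)))"
      using X(1) by (intro exI[of _ "\<lambda>(t, \<mu>). damp t \<mu>"])
        (auto simp: equivariant_def H damp_1 damp_left_translate subset_iff)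
  qed
qed

lemma G_homotopy_equivalent_measures_lim:
  "G_homotopy_equivalent (measures_lim_topology G) left_translate (weak_star_topology UNIV) left_translate"
proof -
  let ?L = "measures_lim_topology G" and ?W = "weak_star_topology UNIV :: 'a measure topology"
  have "equivariant ?L left_translate left_translate id" by (simp add: equivariant_def)
  moreover have "equivariant ?W left_translate left_translate (damp 0)"
    by (simp add: equivariant_def damp_left_translate topspace_weak_star_topology)
  moreover have "homotopic_with (equivariant ?L left_translate left_translate) ?L ?L (damp 0 \<circ> id) id"
    using homotopic_with_damp[OF topspace_measures_lim G_space_measures_lim continuous_map_damp_lim]
    by simp
  moreover have "homotopic_with (equivariant ?W left_translate left_translate) ?W ?W (id \<circ> damp 0) id"
    using homotopic_with_damp[OF _ G_space_weak_star[OF lc] continuous_map_damp]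
    by (simp add: topspace_weak_star_topology)
  ultimately show ?thesis
    unfolding G_homotopy_equivalent_def
    using G_space_measures_lim G_space_weak_star[OF lc] continuous_map_measures_lim_weak_star
      continuous_map_damp_0
    by blast
qed

end

theorem theorem1:
  fixes G :: "nat \<Rightarrow> 'a::{topological_group_add, second_countable_topology, t2_space} set"
  assumes "locally_compact_space (euclidean :: 'a topology)"
    and "\<And>n. subgroup_add (G n)" and "\<And>n. open (G n)"
    and "incseq G" and "(\<Union>n. G n) = UNIV"
  shows "G_homotopy_equivalent
           (measures_lim_topology G) left_translate
           (weak_star_topology UNIV) left_translate"
proof -
  obtain \<phi> :: "nat \<Rightarrow> 'a \<Rightarrow> real"
    where "\<And>n. \<phi> n \<in> cpt_supp_functions UNIV" "\<And>n x. 0 \<le> \<phi> n x" "\<And>n x. \<phi> n x \<le> 1"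
      "\<And>n x. \<phi> n x \<noteq> 0 \<Longrightarrow> x \<in> G n" "\<And>x. (\<lambda>n. \<phi> n x) \<longlonglongrightarrow> 1"
    using exhausting_cutoffs[OF assms] by blast
  with assms interpret exhausted_group G \<phi>
    by unfold_locales
  show ?thesis by (rule G_homotopy_equivalent_measures_lim)
qed

end
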